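(* Let $\mathcal{H}$ be a real Hilbert space with norm $\|\cdot\|$, identified with its dual, let $T>0$, and let $\mathcal{F},\mathcal{F}_T:\mathcal{H}\to\mathbb{R}$ be $C^2$ functionals such that, for some constant $c$ and all $X_1,X_2\in\mathcal{H}$, $$\|D_X\mathcal{F}(X_1)-D_X\mathcal{F}(X_2)\|\le c\|X_1-X_2\|,\qquad \|D_X\mathcal{F}_T(X_1)-D_X\mathcal{F}_T(X_2)\|\le c\|X_1-X_2\|,$$ $$\|D_X\mathcal{F}(0)\|\le c,\qquad \|D_X\mathcal{F}_T(0)\|\le c ,$$ and assume $\lambda>cT(1+T)$. Then the equation $$\frac{\partial\mathcal{U}}{\partial t}-\frac1\lambda D_X\mathcal{U}(X,t)\,\mathcal{U}(X,t)+D_X\mathcal{F}(X)=0,\qquad \mathcal{U}(X,T)=D_X\mathcal{F}_T(X),$$ for $\mathcal{U}:\mathcal{H}\times[0,T]\to\mathcal{H}$, has one and only one solution satisfying the estimates $$\|\mathcal{U}(X,t)\|\le\frac{\lambda(1+T)c(1+\|X\|)}{\lambda-cT(T+1)},\qquad \|D_X\mathcal{U}(X,t)\|\le\frac{\lambda c(1+T)}{\lambda-cT(T+1)}$$ for all $X\in\mathcal{H}$ and $t$.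
   Context: $D_X\mathcal{F}(X)\in\mathcal{H}$ is the gradient of $\mathcal{F}$ at $X$. For $\mathcal{U}:\mathcal{H}\times[0,T]\to\mathcal{H}$, $D_X\mathcal{U}(X,t)\in\mathcal{L}(\mathcal{H};\mathcal{H})$ is the derivative with respect to $X$, $D_X\mathcal{U}(X,t)\,\mathcal{U}(X,t)$ is this operator applied to the vector $\mathcal{U}(X,t)$, and $\|D_X\mathcal{U}(X,t)\|$ is the norm in $\mathcal{L}(\mathcal{H};\mathcal{H})$. A solution is understood in the classical sense: a continuously differentiable function of $(X,t)$ satisfying the equation pointwise together with the terminal condition. *)

theory Defs
  imports "HOL-Analysis.Analysis"
begin

(* Frechet C^1 and C^2; continuity of the derivative is with respect to the operator norm.
   The derivative is taken within S: this is meant for sets such as UNIV \<times> {0..T} with T > 0,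
   where it is unique and is one-sided in time at the two end points. *)
definition C1_on :: "('a::real_normed_vector \<Rightarrow> 'b::real_normed_vector) \<Rightarrow> 'a set \<Rightarrow> bool"
  where "C1_on f S \<longleftrightarrow>
    (\<exists>f' :: 'a \<Rightarrow> 'a \<Rightarrow>\<^sub>L 'b.
      (\<forall>x\<in>S. (f has_derivative blinfun_apply (f' x)) (at x within S)) \<and> continuous_on S f')"

definition C2_on :: "('a::real_normed_vector \<Rightarrow> 'b::real_normed_vector) \<Rightarrow> 'a set \<Rightarrow> bool"
  where "C2_on f S \<longleftrightarrow>
    (\<exists>f' :: 'a \<Rightarrow> 'a \<Rightarrow>\<^sub>L 'b.
      (\<forall>x\<in>S. (f has_derivative blinfun_apply (f' x)) (at x within S)) \<and> C1_on f' S)"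

definition grad :: "('h::real_inner \<Rightarrow> real) \<Rightarrow> 'h \<Rightarrow> 'h"
  where "grad F X = (THE D. GDERIV F X :> D)"

definition D_X :: "('h::real_normed_vector \<Rightarrow> real \<Rightarrow> 'h) \<Rightarrow> 'h \<Rightarrow> real \<Rightarrow> 'h \<Rightarrow> 'h"
  where "D_X U X t = frechet_derivative (\<lambda>Y. U Y t) (at X)"

definition D_t :: "real \<Rightarrow> ('h::real_normed_vector \<Rightarrow> real \<Rightarrow> 'h) \<Rightarrow> 'h \<Rightarrow> real \<Rightarrow> 'h"
  where "D_t T U X t = vector_derivative (\<lambda>s. U X s) (at t within {0..T})"

(* U is a total function of time; only its values on {0..T} matter. *)
definition classical_solution ::
  "real \<Rightarrow> real \<Rightarrow> ('h::real_inner \<Rightarrow> real) \<Rightarrow> ('h \<Rightarrow> real) \<Rightarrow> ('h \<Rightarrow> real \<Rightarrow> 'h) \<Rightarrow> bool"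
  where "classical_solution lam T F F\<^sub>T U \<longleftrightarrow>
    C1_on (\<lambda>(X, t). U X t) (UNIV \<times> {0..T}) \<and>
    (\<forall>X. \<forall>t\<in>{0..T}. D_t T U X t - (1 / lam) *\<^sub>R D_X U X t (U X t) + grad F X = 0) \<and>
    (\<forall>X. U X T = grad F\<^sub>T X)"

end

theory Submission
  imports Defs
begin

text \<open>
  The equation is solved by the method of characteristics. Write \<open>f\<close> and \<open>g\<close> for the gradients of
  \<open>F\<close> and \<open>F\<^sub>T\<close>. If \<open>U\<close> solves the equation and \<open>Y\<close> follows the velocity field \<open>- U / lam\<close> from \<open>X\<close>
  at time \<open>t\<close>, then \<open>Z s = U (Y s) s\<close> satisfies

    \<open>Y s = X - (1 / lam) * (integral of Z over [t, s])\<close>, \<open>Z s = g (Y T) + (integral of f(Y) over [s, T])\<close>,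

  a system that no longer mentions \<open>U\<close>. Regarding the second formula as a map \<open>Z = costate_of Y\<close> and
  the first as \<open>Y = trajectory X t Z\<close>, the system is a fixed-point equation for \<open>Z\<close> in the space of
  continuous paths over \<open>{0..T}\<close>. The trajectory is Lipschitz in \<open>Z\<close> with constant
  \<open>T / lam\<close>, \<open>costate_of\<close> is Lipschitz in \<open>Y\<close> with constant \<open>c * (1 + T)\<close>, and the product of the two is below \<open>1\<close> exactly when
  \<open>lam > c * T * (1 + T)\<close>. Hence there is one fixed point \<open>costate X t\<close>, and
  \<open>solution X t = costate X t t\<close>. The constant in the two estimates is \<open>c * (1 + T)\<close> divided by
  \<open>1 - c * T * (1 + T) / lam\<close>: the gain of \<open>costate_of\<close> amplified by the feedback through the
  trajectory.

  Posing the fixed-point problem for paths on the whole interval \<open>{0..T}\<close>, and not only on \<open>{t..T}\<close>, puts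
  all problems in the same space and makes the flow property immediate: the fixed point for \<open>(X, t)\<close> is
  also the fixed point for \<open>(Y s, s)\<close> (\<open>costate_flow\<close>), so \<open>solution (Y s) s = Z s\<close>
  (\<open>solution_along_characteristic\<close>).

  The gradients are \<open>C\<^sup>1\<close>, so \<open>costate_of\<close> is \<open>C\<^sup>1\<close> on path space, where composition with a \<open>C\<^sup>1\<close> function
  is \<open>C\<^sup>1\<close> because paths have compact image (\<open>nemytskii_has_derivative\<close>). Differentiating the fixed-point
  equation in \<open>X\<close> gives a linear equation for the derivative whose solution depends continuously, in operator
  norm, on \<open>(X, t)\<close> (\<open>costate_has_derivative\<close>, \<open>solution_deriv_continuous\<close>). Time regularity and the
  equation then follow without differentiating the fixed point in \<open>t\<close>: by the flow property,
  \<open>solution X' t' = (solution X' t' - solution (Y t') t') + Z t'\<close>, in which the difference is governed by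
  the derivative in space and \<open>Y\<close>, \<open>Z\<close> have the known time derivatives \<open>- Z / lam\<close> and \<open>- f(Y)\<close>
  (\<open>solution_joint_derivative\<close>).

  For uniqueness let \<open>V\<close> be another solution, with \<open>D_X V\<close> bounded as the second estimate demands, and compare it with \<open>solution\<close> along a
  characteristic of the latter: \<open>w s = V (Y s) s - Z s\<close> satisfies \<open>w' = (1 / lam) * D_X V w\<close> and
  \<open>w T = 0\<close>, so it vanishes by Gronwall's inequality (\<open>solution_unique\<close>).
\<close>

section \<open>Riesz representation and gradients\<close>

text \<open>
  The representing vector is the minimiser of \<open>(norm v)\<^sup>2 / 2 - \<phi> v\<close>: the parallelogram law makes every
  minimising sequence Cauchy, and the first-order condition at the limit is the representation.
\<close>

lemma riesz_representation:
  fixes \<phi> :: "'h::{real_inner, complete_space} \<Rightarrow>\<^sub>L real"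
  shows "\<exists>!w. \<forall>v. \<phi> v = w \<bullet> v"
proof -
  define J where "J v = (norm v)\<^sup>2 / 2 - \<phi> v" for v
  have below: "- (norm \<phi>)\<^sup>2 / 2 \<le> J v" for v
  proof -
    have "\<phi> v \<le> norm \<phi> * norm v"
      using norm_blinfun[of \<phi> v] by simp
    moreover have "0 \<le> (norm v - norm \<phi>)\<^sup>2" by simp
    ultimately show ?thesis
      unfolding J_def power2_diff by (simp add: algebra_simps)
  qed
  define m where "m = Inf (range J)"
  have bdd: "bdd_below (range J)"
    using below by (intro bdd_belowI) auto
  have m_le: "m \<le> J v" for v
    unfolding m_def by (rule cInf_lower) (use bdd in auto)
  have "\<exists>v. J v < m + 1 / Suc n" for n
    using cInf_lessD[of "range J" "m + 1 / Suc n"] by (auto simp: m_def)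
  then obtain u where u: "J (u n) < m + 1 / Suc n" for n by metis
  have parallelogram: "(norm (v - w))\<^sup>2 = 4 * (J v + J w - 2 * J ((1/2) *\<^sub>R (v + w)))" for v w
    unfolding J_def blinfun.scaleR_right blinfun.add_right power2_norm_eq_inner
    by (simp add: inner_add inner_diff inner_commute field_simps)
  have close: "(norm (v - w))\<^sup>2 \<le> 4 * (J v - m + (J w - m))" for v w
    using parallelogram[of v w] m_le[of "(1/2) *\<^sub>R (v + w)"] by simp
  have Cauchy: "Cauchy u"
  proof (rule metric_CauchyI)
    fix e :: real assume "0 < e"
    then obtain k where k: "inverse (real (Suc k)) < e\<^sup>2 / 8"
      using reals_Archimedean[of "e\<^sup>2 / 8"] by auto
    have small: "J (u i) - m < e\<^sup>2 / 8" if "i \<ge> k" for i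
    proof -
      have "1 / real (Suc i) \<le> inverse (real (Suc k))"
        using that by (simp add: field_simps)
      then show ?thesis using u[of i] k by simp
    qed
    have "dist (u i) (u j) < e" if "i \<ge> k" "j \<ge> k" for i j
    proof -
      have "(norm (u i - u j))\<^sup>2 < e\<^sup>2"
        using close[of "u i" "u j"] small[OF that(1)] small[OF that(2)] by simp
      then show ?thesis
        using \<open>0 < e\<close> by (simp add: dist_norm power_less_imp_less_base)
    qed
    then show "\<exists>M. \<forall>i\<ge>M. \<forall>j\<ge>M. dist (u i) (u j) < e" by blast
  qed
  then obtain w where w: "u \<longlonglongrightarrow> w"
    using Cauchy_convergent convergent_def by blast
  have "(\<lambda>n. J (u n)) \<longlonglongrightarrow> J w"
    unfolding J_def by (intro tendsto_intros w) auto
  moreover have "(\<lambda>n. m + 1 / Suc n) \<longlonglongrightarrow> m + 0"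
    by (intro tendsto_intros LIMSEQ_Suc lim_1_over_n)
  ultimately have "J w \<le> m + 0"
    by (rule LIMSEQ_le) (use u less_imp_le in blast)
  then have min: "J w \<le> J v" for v
    using m_le[of v] by simp
  have "\<phi> v = w \<bullet> v" for v
  proof (cases "v = 0")
    case False
    define a where "a = w \<bullet> v - \<phi> v"
    \<comment> \<open>the minimiser of the quadratic polynomial \<open>J (w + t v)\<close> in \<open>t\<close>\<close>
    define t where "t = - a / (v \<bullet> v)"
    have v: "v \<bullet> v > 0" using False by simp
    have "J (w + t *\<^sub>R v) = J w + t * a + t\<^sup>2 * (v \<bullet> v) / 2"
      unfolding J_def a_def blinfun.add_right blinfun.scaleR_right power2_norm_eq_inner
      by (simp add: inner_add inner_commute power2_eq_square field_simps)
    moreover have "t * a + t\<^sup>2 * (v \<bullet> v) / 2 = - a\<^sup>2 / (2 * (v \<bullet> v))"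
      unfolding t_def using v by (simp add: field_simps power2_eq_square)
    ultimately have "0 \<le> - a\<^sup>2 / (2 * (v \<bullet> v))"
      using min[of "w + t *\<^sub>R v"] by linarith
    then have "a = 0"
      using v by (simp add: divide_le_0_iff)
    then show ?thesis by (simp add: a_def)
  qed simp
  moreover have "w' = w" if "\<forall>v. \<phi> v = w' \<bullet> v" for w'
    using that calculation by (metis vector_eq_rdot)
  ultimately show ?thesis by blast
qed

definition riesz :: "('h::{real_inner, complete_space} \<Rightarrow>\<^sub>L real) \<Rightarrow> 'h"
  where "riesz \<phi> = (THE w. \<forall>v. \<phi> v = w \<bullet> v)"

lemma inner_riesz: "riesz \<phi> \<bullet> v = \<phi> v"
  unfolding riesz_def using theI'[OF riesz_representation, of \<phi>] by metis

lemma riesz_unique: "(\<And>v. blinfun_apply \<phi> v = w \<bullet> v) \<Longrightarrow> riesz \<phi> = w"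
  using riesz_representation[of \<phi>] inner_riesz[of \<phi>] by metis

lemma norm_riesz_le: "norm (riesz \<phi>) \<le> norm \<phi>"
proof (cases "riesz \<phi> = 0")
  case False
  have "norm (riesz \<phi>) * norm (riesz \<phi>) = \<phi> (riesz \<phi>)"
    by (metis inner_riesz power2_eq_square power2_norm_eq_inner)
  also have "\<dots> \<le> norm \<phi> * norm (riesz \<phi>)"
    using norm_blinfun[of \<phi> "riesz \<phi>"] by simp
  finally show ?thesis using False by simp
qed simp

lemma bounded_linear_riesz:
  "bounded_linear (riesz :: ('h::{real_inner, complete_space} \<Rightarrow>\<^sub>L real) \<Rightarrow> 'h)"
proof (rule bounded_linear_intro)
  show "riesz (\<phi> + \<psi>) = riesz \<phi> + riesz \<psi>" for \<phi> \<psi> :: "'h \<Rightarrow>\<^sub>L real"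
    by (rule riesz_unique) (simp add: inner_riesz inner_add_left blinfun.add_left)
  show "riesz (r *\<^sub>R \<phi>) = r *\<^sub>R riesz \<phi>" for r and \<phi> :: "'h \<Rightarrow>\<^sub>L real"
    by (rule riesz_unique) (simp add: inner_riesz blinfun.scaleR_left)
  show "norm (riesz \<phi>) \<le> norm \<phi> * 1" for \<phi> :: "'h \<Rightarrow>\<^sub>L real"
    by (simp add: norm_riesz_le)
qed

lemma grad_eq_riesz:
  fixes F :: "'h::{real_inner, complete_space} \<Rightarrow> real"
  assumes "(F has_derivative blinfun_apply F') (at X)"
  shows "grad F X = riesz F'"
  unfolding grad_def
proof (rule the_equality)
  show "GDERIV F X :> riesz F'"
    proof -
    have "blinfun_apply F' = (\<lambda>h. h \<bullet> riesz F')"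
      using inner_riesz[of F'] by (metis inner_commute)
    then show ?thesis using assms by (simp add: gderiv_def)
  qed
  show "D = riesz F'" if "GDERIV F X :> D" for D
  proof (rule riesz_unique[symmetric])
    show "F' v = D \<bullet> v" for v
      using has_derivative_unique[OF assms that[unfolded gderiv_def]]
      by (metis inner_commute)
  qed
qed

text \<open>
  The gradient is the bounded linear map \<open>riesz\<close> applied to the Frechet derivative, so it inherits
  its differentiability.
\<close>

lemma C2_on_imp_grad_C1:
  fixes F :: "'h::{real_inner, complete_space} \<Rightarrow> real"
  assumes "C2_on F UNIV"
  obtains H :: "'h \<Rightarrow> 'h \<Rightarrow>\<^sub>L 'h"
  where "\<And>X. (grad F has_derivative blinfun_apply (H X)) (at X)" "continuous_on UNIV H"
proof -
  obtain F' F'' where F': "\<And>X. (F has_derivative blinfun_apply (F' X)) (at X)"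
    and F'': "\<And>X. (F' has_derivative blinfun_apply (F'' X)) (at X)" "continuous_on UNIV F''"
    using assms unfolding C2_on_def C1_on_def by auto
  have grad: "grad F = (\<lambda>X. riesz (F' X))"
    using grad_eq_riesz[OF F'] by auto
  define H where "H X = Blinfun riesz o\<^sub>L F'' X" for X
  have "blinfun_apply (H X) = (\<lambda>v. riesz (F'' X v))" for X
    by (auto simp: H_def bounded_linear_Blinfun_apply[OF bounded_linear_riesz])
  then have "(grad F has_derivative blinfun_apply (H X)) (at X)" for X
    using bounded_linear.has_derivative[OF bounded_linear_riesz F''(1)] by (simp add: grad)
  moreover have "continuous_on UNIV H"
    unfolding H_def by (intro continuous_intros F''(2))
  ultimately show ?thesis using that by blast
qed

section \<open>Integrals of Hilbert-space-valued paths\<close>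

text \<open>
  The path is integrated as a path of functionals \<open>v \<mapsto> x s \<bullet> v\<close>, and \<open>riesz\<close> brings the result back to
  the Hilbert space. The dual space is an instance of \<open>banach\<close>, where continuous functions are integrable;
  as \<open>riesz\<close> inverts \<open>blinfun_inner_right\<close> and does not increase norms, bounds and the fundamental theorem
  of calculus carry over.
\<close>

definition vintegral :: "real \<Rightarrow> real \<Rightarrow> (real \<Rightarrow> 'h) \<Rightarrow> 'h::{real_inner, complete_space}"
  where "vintegral a b x = riesz (integral {a..b} (\<lambda>s. blinfun_inner_right (x s)))"

lemma continuous_on_inner_functional:
  "continuous_on S x \<Longrightarrow> continuous_on S (\<lambda>s. blinfun_inner_right (x s))"
  by (rule bounded_linear.continuous_on[OF bounded_linear_blinfun_inner_right])

lemma riesz_inner_functional: "riesz (blinfun_inner_right w) = w"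
  by (rule riesz_unique) simp

lemma norm_inner_functional: "norm (blinfun_inner_right w) \<le> norm w"
  by (rule norm_blinfun_bound) (auto simp: Cauchy_Schwarz_ineq2)

lemma vintegral_has_vector_derivative:
  assumes "continuous_on {a..b} x" and "s \<in> {a..b}"
  shows "((\<lambda>r. vintegral a r x) has_vector_derivative x s) (at s within {a..b})"
  using bounded_linear.has_vector_derivative[OF bounded_linear_riesz
      integral_has_vector_derivative[OF continuous_on_inner_functional[OF assms(1)] assms(2)]]
  by (simp add: vintegral_def riesz_inner_functional)

lemma vintegral_add:
  assumes "continuous_on {a..b} x" "continuous_on {a..b} y"
  shows "vintegral a b (\<lambda>s. x s + y s) = vintegral a b x + vintegral a b y"
  unfolding vintegral_def linear_add[OF bounded_linear.linear[OF bounded_linear_blinfun_inner_right]]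
  by (simp add: integral_add integrable_continuous_real[OF continuous_on_inner_functional] assms
      linear_add[OF bounded_linear.linear[OF bounded_linear_riesz]])

lemma vintegral_scaleR: "vintegral a b (\<lambda>s. k *\<^sub>R x s) = k *\<^sub>R vintegral a b x"
  unfolding vintegral_def linear_scale[OF bounded_linear.linear[OF bounded_linear_blinfun_inner_right]]
  by (simp add: linear_scale[OF bounded_linear.linear[OF bounded_linear_riesz]])

lemma vintegral_diff_bound:
  assumes "a \<le> r" "r \<le> s" "s \<le> b" "continuous_on {a..b} x"
    and "\<And>u. u \<in> {a..b} \<Longrightarrow> norm (x u) \<le> B"
  shows "norm (vintegral a s x - vintegral a r x) \<le> B * (s - r)"
proof -
  let ?f = "\<lambda>u. blinfun_inner_right (x u)"
  have cont: "continuous_on {a..s} ?f" "continuous_on {r..s} ?f"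
    using assms by (auto intro!: continuous_on_inner_functional elim: continuous_on_subset)
  have "integral {a..s} ?f - integral {a..r} ?f = integral {r..s} ?f"
    using Henstock_Kurzweil_Integration.integral_combine[OF assms(1,2) integrable_continuous_real[OF cont(1)]] by (simp add: algebra_simps)
  then have "vintegral a s x - vintegral a r x = riesz (integral {r..s} ?f)"
    unfolding vintegral_def
    by (simp flip: bounded_linear_riesz[THEN bounded_linear.linear, THEN linear_diff])
  also have "norm \<dots> \<le> norm (integral {r..s} ?f)" by (rule norm_riesz_le)
  also have "\<dots> \<le> B * (s - r)"
    using assms cont(2)
    by (intro integral_bound) (auto intro!: order_trans[OF norm_inner_functional])
  finally show ?thesis .
qed

lemma vintegral_same [simp]: "vintegral a a x = 0"
  by (simp add: vintegral_def linear_0[OF bounded_linear.linear[OF bounded_linear_riesz]])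

section \<open>Fixed points of contractions depending on a parameter\<close>

text \<open>
  Comparing \<open>z q\<close> with \<open>\<Gamma> q (z p)\<close> leaves the distance \<open>dist (z q) (z p)\<close> on both sides of an estimate,
  on the right with the factor \<open>\<theta> < 1\<close>, and so bounds it by the change of \<open>\<Gamma> q (z p)\<close> in \<open>q\<close> alone.
\<close>

lemma fixed_point_continuous:
  fixes \<Gamma> :: "'p::topological_space \<Rightarrow> 'e::metric_space \<Rightarrow> 'e"
  assumes contraction: "\<And>p x y. p \<in> S \<Longrightarrow> dist (\<Gamma> p x) (\<Gamma> p y) \<le> \<theta> * dist x y" and "\<theta> < 1"
    and fixed: "\<And>p. p \<in> S \<Longrightarrow> \<Gamma> p (z p) = z p"
    and cont: "\<And>x. continuous_on S (\<lambda>p. \<Gamma> p x)"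
  shows "continuous_on S z"
  unfolding continuous_on_def
proof
  fix p assume p: "p \<in> S"
  have bound: "dist (z q) (z p) \<le> dist (\<Gamma> q (z p)) (z p) / (1 - \<theta>)" if q: "q \<in> S" for q
  proof -
    have "dist (z q) (z p) \<le> dist (\<Gamma> q (z q)) (\<Gamma> q (z p)) + dist (\<Gamma> q (z p)) (z p)"
      by (metis fixed[OF q] dist_triangle)
    with contraction[OF q, of "z q" "z p"]
    have "(1 - \<theta>) * dist (z q) (z p) \<le> dist (\<Gamma> q (z p)) (z p)"
      by (simp add: algebra_simps)
    then show ?thesis using \<open>\<theta> < 1\<close> by (simp add: field_simps)
  qed
  have "((\<lambda>q. \<Gamma> q (z p)) \<longlongrightarrow> z p) (at p within S)"
    using cont[of "z p", unfolded continuous_on_def, rule_format, OF p] by (simp only: fixed[OF p])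
  then have "((\<lambda>q. dist (\<Gamma> q (z p)) (z p) / (1 - \<theta>)) \<longlongrightarrow> dist (z p) (z p) / (1 - \<theta>)) (at p within S)"
    using \<open>\<theta> < 1\<close> by (intro tendsto_divide tendsto_dist tendsto_const) auto
  then have lim: "((\<lambda>q. dist (\<Gamma> q (z p)) (z p) / (1 - \<theta>)) \<longlongrightarrow> 0) (at p within S)"
    by simp
  have "((\<lambda>q. dist (z q) (z p)) \<longlongrightarrow> 0) (at p within S)"
    by (rule tendsto_sandwich[OF _ _ tendsto_const lim])
      (auto simp: eventually_at_filter intro!: always_eventually bound)
  then show "(z \<longlongrightarrow> z p) (at p within S)"
    by (rule tendsto_dist_iff[THEN iffD2])
qed

text \<open>
  Differentiating \<open>\<Gamma> x (z x) = z x\<close> formally gives \<open>L = A + B L\<close>. The remainder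
  \<open>D = z x - z a - L (x - a)\<close> then satisfies \<open>D - B D = o(norm (x - a))\<close>, the Lipschitz bound on \<open>z\<close> being
  what turns \<open>o(norm (x - a, z x - z a))\<close> into \<open>o(norm (x - a))\<close>, and \<open>norm B < 1\<close> passes this to \<open>D\<close>.
\<close>

lemma fixed_point_has_derivative:
  fixes \<Gamma> :: "'x::real_normed_vector \<Rightarrow> 'e::real_normed_vector \<Rightarrow> 'e"
    and A L :: "'x \<Rightarrow>\<^sub>L 'e" and B :: "'e \<Rightarrow>\<^sub>L 'e"
  assumes \<Gamma>: "((\<lambda>(x, z). \<Gamma> x z) has_derivative (\<lambda>(\<xi>, \<zeta>). A \<xi> + B \<zeta>)) (at (a, z a))"
    and fixed: "\<And>x. \<Gamma> x (z x) = z x"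
    and lipschitz: "\<And>x. norm (z x - z a) \<le> K * norm (x - a)"
    and "norm B < 1" and L: "\<And>\<xi>. L \<xi> = A \<xi> + B (L \<xi>)"
  shows "(z has_derivative L) (at a)"
  unfolding has_derivative_at_alt
proof (intro conjI allI impI)
  show "bounded_linear L" by (rule blinfun.bounded_linear_right)
  fix e :: real assume "0 < e"
  \<comment> \<open>the two factors compensate \<open>norm (x - a, z x - z a) \<le> (1 + \<bar>K\<bar>) * norm (x - a)\<close> and the inversion of \<open>1 - B\<close>\<close>
  define e' where "e' = e * (1 - norm B) / (1 + \<bar>K\<bar>)"
  have "0 < e'" using \<open>0 < e\<close> \<open>norm B < 1\<close> by (simp add: e'_def)
  then obtain d where "0 < d" and d: "\<And>x w. norm (x - a, w - z a) < d \<Longrightarrow>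
      norm (\<Gamma> x w - \<Gamma> a (z a) - (A (x - a) + B (w - z a))) \<le> e' * norm (x - a, w - z a)"
    using \<Gamma>[unfolded has_derivative_at_alt] by (auto simp: split_paired_all)
  have "norm (z x - z a - L (x - a)) \<le> e * norm (x - a)" if x: "norm (x - a) < d / (1 + \<bar>K\<bar>)" for x
  proof -
    define D where "D = z x - z a - L (x - a)"
    have pair: "norm (x - a, z x - z a) \<le> (1 + \<bar>K\<bar>) * norm (x - a)"
    proof -
      have "norm (x - a, z x - z a) \<le> norm (x - a) + norm (z x - z a)"
        by (rule norm_Pair_le)
      also have "norm (z x - z a) \<le> \<bar>K\<bar> * norm (x - a)"
        using lipschitz[of x] by (rule order_trans) (simp add: mult_right_mono)
      finally show ?thesis by (simp add: algebra_simps)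
    qed
    also have "\<dots> < d" using x by (simp add: field_simps)
    finally have "norm (\<Gamma> x (z x) - \<Gamma> a (z a) - (A (x - a) + B (z x - z a))) \<le> e' * norm (x - a, z x - z a)"
      by (rule d)
    also have "\<dots> \<le> e' * ((1 + \<bar>K\<bar>) * norm (x - a))"
      using pair \<open>0 < e'\<close> by simp
    also have "\<dots> = e * (1 - norm B) * norm (x - a)"
      unfolding e'_def using abs_ge_zero[of K] by (simp add: field_simps del: abs_ge_zero)
    also have "\<Gamma> x (z x) - \<Gamma> a (z a) - (A (x - a) + B (z x - z a)) = D - B D"
      using L[of "x - a"] unfolding fixed D_def blinfun.diff_right[of B _ "L (x - a)"]
      by (simp add: algebra_simps)
    finally have "norm (D - B D) \<le> e * (1 - norm B) * norm (x - a)" .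
    moreover have "norm D \<le> norm (D - B D) + norm B * norm D"
      using norm_triangle_sub[of D "B D"] norm_blinfun[of B D] by linarith
    ultimately have "(1 - norm B) * norm D \<le> (1 - norm B) * (e * norm (x - a))"
      by (simp add: algebra_simps)
    then show ?thesis using \<open>norm B < 1\<close> by (simp add: D_def)
  qed
  then show "\<exists>d>0. \<forall>x. norm (x - a) < d \<longrightarrow> norm (z x - z a - L (x - a)) \<le> e * norm (x - a)"
    using \<open>0 < d\<close> by (intro exI[of _ "d / (1 + \<bar>K\<bar>)"]) auto
qed

text \<open>
  \<open>L = (1 - B)^(-1) A\<close>, built vector by vector: each \<open>L \<xi>\<close> is the fixed point of a contraction, and
  linearity follows from uniqueness of that fixed point.
\<close>

lemma resolvent_exists:
  fixes A :: "'x::real_normed_vector \<Rightarrow>\<^sub>L 'e::{real_normed_vector, complete_space}"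
    and B :: "'e \<Rightarrow>\<^sub>L 'e"
  assumes "norm B < 1"
  obtains L :: "'x \<Rightarrow>\<^sub>L 'e" where "L = A + (B o\<^sub>L L)"
proof -
  have "\<exists>!\<eta>. A \<xi> + B \<eta> = \<eta>" for \<xi>
  proof (rule banach_fix_type)
    show "\<forall>x y. dist (A \<xi> + B x) (A \<xi> + B y) \<le> norm B * dist x y"
      by (simp add: dist_norm norm_blinfun flip: blinfun.diff_right)
  qed (use assms in auto)
  then obtain l where l: "\<And>\<xi>. l \<xi> = A \<xi> + B (l \<xi>)"
    and unique: "\<And>\<xi> \<eta>. \<eta> = A \<xi> + B \<eta> \<Longrightarrow> \<eta> = l \<xi>"
    by metis
  have "norm (l \<xi>) \<le> norm \<xi> * (norm A / (1 - norm B))" for \<xi>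
  proof -
    have "norm (l \<xi>) \<le> norm (A \<xi>) + norm (B (l \<xi>))"
      using norm_triangle_ineq[of "A \<xi>" "B (l \<xi>)"] l[of \<xi>] by simp
    also have "\<dots> \<le> norm A * norm \<xi> + norm B * norm (l \<xi>)"
      by (intro add_mono norm_blinfun)
    finally show ?thesis using assms by (simp add: field_simps)
  qed
  moreover have "l (\<xi> + \<xi>') = l \<xi> + l \<xi>'" for \<xi> \<xi>'
    by (rule unique[symmetric]) (simp add: blinfun.add_right, metis l add.assoc add.left_commute)
  moreover have "l (r *\<^sub>R \<xi>) = r *\<^sub>R l \<xi>" for r \<xi>
    by (rule unique[symmetric]) (simp add: blinfun.scaleR_right, metis l scaleR_add_right)
  ultimately have "bounded_linear l"
    by (intro bounded_linear_intro)
  then have "Blinfun l = A + (B o\<^sub>L Blinfun l)"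
    by (intro blinfun_eqI) (simp add: bounded_linear_Blinfun_apply blinfun.add_left flip: l)
  then show ?thesis using that by blast
qed

lemma derivative_norm_le_lipschitz:
  fixes f' :: "'a::real_normed_vector \<Rightarrow>\<^sub>L 'b::real_normed_vector"
  assumes "(f has_derivative blinfun_apply f') (at x)"
    and lipschitz: "\<And>y. norm (f y - f x) \<le> M * norm (y - x)" and "0 \<le> M"
  shows "norm f' \<le> M"
proof (rule field_le_epsilon)
  fix e :: real assume "0 < e"
  then obtain d where "0 < d"
    and d: "\<And>y. norm (y - x) < d \<Longrightarrow> norm (f y - f x - f' (y - x)) \<le> e * norm (y - x)"
    using assms(1) unfolding has_derivative_at_alt by blast
  show "norm f' \<le> M + e"
  proof (rule norm_blinfun_bound)
    fix v
    show "norm (f' v) \<le> (M + e) * norm v"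
    proof (cases "v = 0")
      case False
      define t where "t = d / (2 * norm v)"
      have t: "0 < t" "norm (t *\<^sub>R v) < d"
        using False \<open>0 < d\<close> by (simp_all add: t_def)
      have "norm (f' (t *\<^sub>R v)) \<le> M * norm (t *\<^sub>R v) + e * norm (t *\<^sub>R v)"
        using d[of "x + t *\<^sub>R v"] t(2) lipschitz[of "x + t *\<^sub>R v"]
          norm_triangle_ineq3[of "f' (t *\<^sub>R v)" "f (x + t *\<^sub>R v) - f x"]
        by (simp add: norm_minus_commute)
      then have "t * norm (f' v) \<le> t * ((M + e) * norm v)"
        using t(1) by (simp add: blinfun.scaleR_right algebra_simps)
      then show ?thesis using t(1) by simp
    qed simp
  qed (use assms(3) \<open>0 < e\<close> in simp)
qed

section \<open>Operators on the space of continuous paths\<close>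

text \<open>
  This is stronger than uniform continuity on \<open>K\<close> because \<open>y\<close> may lie outside \<open>K\<close>; in infinite dimension no
  compact neighbourhood of \<open>K\<close> is available.
\<close>

lemma uniformly_close_to_compact:
  fixes f :: "'a::metric_space \<Rightarrow> 'b::metric_space"
  assumes "compact K" "continuous_on UNIV f" "0 < e"
  obtains d where "0 < d" "\<And>x y. x \<in> K \<Longrightarrow> dist y x < d \<Longrightarrow> dist (f y) (f x) < e"
proof -
  define B where "B x = f -` ball (f x) (e / 2)" for x
  have "open (B x)" for x
    unfolding B_def using open_vimage[OF open_ball assms(2)] .
  moreover have "K \<subseteq> \<Union>(B ` K)"
    using \<open>0 < e\<close> by (auto simp: B_def)
  ultimately obtain d where d: "0 < d" "\<And>x. x \<in> K \<Longrightarrow> \<exists>G\<in>B ` K. ball x d \<subseteq> G"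
    using Heine_Borel_lemma[OF \<open>compact K\<close>, of "B ` K"] by (metis imageE)
  show ?thesis
  proof (rule that[OF d(1)])
    fix x y assume "x \<in> K" "dist y x < d"
    then obtain k where k: "ball x d \<subseteq> B k"
      using d(2) by blast
    have "y \<in> B k" "x \<in> B k"
      using k \<open>dist y x < d\<close> d(1) by (auto simp: dist_commute subset_iff)
    then show "dist (f y) (f x) < e"
      unfolding B_def using dist_triangle_half_r[of "f k" "f y" e "f x"] by auto
  qed
qed

lemma clamp_Icc:
  fixes T :: real
  assumes "0 \<le> T"
  shows "clamp 0 T s \<in> {0..T}"
  using clamp_in_interval[of 0 T s] assms by simp

lemma clamp_Icc_id: "s \<in> {0..T} \<Longrightarrow> clamp 0 T s = s" for T :: real
  by (rule clamp_cancel_cbox) simp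

lemma abs_clamp_diff_le: "\<bar>clamp 0 T r - clamp 0 T s\<bar> \<le> \<bar>r - s\<bar>" for T :: real
  using dist_clamps_le_dist_args[of 0 T r s] by (simp add: dist_real_def)

text \<open>
  Continuous paths over \<open>{0..T}\<close> are represented in the Banach space of bounded continuous functions on all
  of \<open>real\<close>, extended by their end values. The operators \<open>nemytskii T f\<close> and \<open>primitive T\<close> look at their
  argument on \<open>{0..T}\<close> only and return clamped paths.
\<close>

definition clamped_path :: "real \<Rightarrow> (real \<Rightarrow> 'b::metric_space) \<Rightarrow> real \<Rightarrow>\<^sub>C 'b"
  where "clamped_path T x = Bcontfun (\<lambda>s. x (clamp 0 T s))"

lemma clamped_path_apply:
  assumes "continuous_on {0..T} x"
  shows "clamped_path T x s = x (clamp 0 T s)"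
proof -
  obtain g :: "real \<Rightarrow>\<^sub>C 'a" where "\<And>s. g s = x (clamp 0 T s)"
    using continuous_on_cbox_bcontfunE[of 0 T x] assms by auto
  then have "(\<lambda>s. x (clamp 0 T s)) = apply_bcontfun g" by auto
  then show ?thesis
    unfolding clamped_path_def by (metis apply_bcontfun_inverse)
qed

definition nemytskii :: "real \<Rightarrow> ('a::metric_space \<Rightarrow> 'b::metric_space) \<Rightarrow> (real \<Rightarrow>\<^sub>C 'a) \<Rightarrow> real \<Rightarrow>\<^sub>C 'b"
  where "nemytskii T f Y = clamped_path T (\<lambda>s. f (Y s))"

lemma continuous_on_compose_path:
  "continuous_on UNIV f \<Longrightarrow> continuous_on S (\<lambda>s. f (apply_bcontfun Y s))"
  by (rule continuous_on_compose2) auto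

lemma nemytskii_apply:
  "continuous_on UNIV f \<Longrightarrow> nemytskii T f Y s = f (Y (clamp 0 T s))"
  unfolding nemytskii_def by (rule clamped_path_apply) (rule continuous_on_compose_path)

definition nemytskii_deriv ::
  "real \<Rightarrow> ('a::real_normed_vector \<Rightarrow> 'a \<Rightarrow>\<^sub>L 'b::real_normed_vector) \<Rightarrow> (real \<Rightarrow>\<^sub>C 'a) \<Rightarrow> (real \<Rightarrow>\<^sub>C 'a) \<Rightarrow>\<^sub>L (real \<Rightarrow>\<^sub>C 'b)"
  where "nemytskii_deriv T f' Y = Blinfun (\<lambda>\<eta> :: real \<Rightarrow>\<^sub>C 'a. clamped_path T (\<lambda>s. f' (Y s) (\<eta> s)))"

lemma nemytskii_deriv_apply:
  fixes f' :: "'a::real_normed_vector \<Rightarrow> 'a \<Rightarrow>\<^sub>L 'b::real_normed_vector"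
  assumes "0 \<le> T" and f': "continuous_on UNIV f'"
  shows "nemytskii_deriv T f' Y \<eta> s = f' (Y (clamp 0 T s)) (\<eta> (clamp 0 T s))"
proof -
  define D where "D \<eta> = clamped_path T (\<lambda>s. f' (Y s) (\<eta> s))" for \<eta> :: "real \<Rightarrow>\<^sub>C 'a"
  have D: "D \<eta> s = f' (Y (clamp 0 T s)) (\<eta> (clamp 0 T s))" for \<eta> s
    unfolding D_def
    by (rule clamped_path_apply) (intro continuous_intros continuous_on_compose_path[OF f'] continuous_on_apply_bcontfun)
  have "bounded ((\<lambda>s. f' (Y s)) ` {0..T})"
    by (intro compact_imp_bounded compact_continuous_image continuous_on_compose_path[OF f'] compact_Icc)
  then obtain K where K: "norm (f' (Y s)) \<le> K" if "s \<in> {0..T}" for s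
    unfolding bounded_iff by blast
  have "norm (D \<eta>) \<le> norm \<eta> * K" for \<eta>
  proof (rule norm_bound)
    fix s
    note s = clamp_Icc[OF \<open>0 \<le> T\<close>, of s]
    have "norm (D \<eta> s) \<le> norm (f' (Y (clamp 0 T s))) * norm (\<eta> (clamp 0 T s))"
      unfolding D by (rule norm_blinfun)
    also have "\<dots> \<le> K * norm \<eta>"
      using K[OF s] by (intro mult_mono norm_bounded) (auto intro: order_trans[OF norm_ge_zero])
    finally show "norm (D \<eta> s) \<le> norm \<eta> * K" by (simp add: mult.commute)
  qed
  then have "bounded_linear D"
    by (intro bounded_linear_intro[where K = K] bcontfun_eqI)
      (simp_all add: D blinfun.bilinear_simps)
  then show ?thesis
    unfolding nemytskii_deriv_def by (simp add: bounded_linear_Blinfun_apply D flip: D_def)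
qed

lemma compact_path_image: "compact (apply_bcontfun Y ` {0..T})" for T :: real
  by (intro compact_continuous_image) auto

lemma nemytskii_deriv_diff_le:
  fixes Y1 Y2 :: "real \<Rightarrow>\<^sub>C 'a::real_normed_vector"
  assumes "0 \<le> T" and f': "continuous_on UNIV f'"
    and "\<And>s. s \<in> {0..T} \<Longrightarrow> norm (f' (Y1 s) - f' (Y2 s)) \<le> e"
  shows "norm (nemytskii_deriv T f' Y1 - nemytskii_deriv T f' Y2) \<le> e"
proof (rule norm_blinfun_bound)
  show e: "0 \<le> e"
    using assms(1) assms(3)[of 0] by (auto intro: order_trans[OF norm_ge_zero])
  fix \<eta>
  show "norm ((nemytskii_deriv T f' Y1 - nemytskii_deriv T f' Y2) \<eta>) \<le> e * norm \<eta>"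
  proof (rule norm_bound)
    fix s
    let ?s = "clamp 0 T s"
    have "norm (((nemytskii_deriv T f' Y1 - nemytskii_deriv T f' Y2) \<eta>) s)
        = norm ((f' (Y1 ?s) - f' (Y2 ?s)) (\<eta> ?s))"
      by (simp add: blinfun.diff_left nemytskii_deriv_apply[OF assms(1) f'])
    also have "\<dots> \<le> norm (f' (Y1 ?s) - f' (Y2 ?s)) * norm (\<eta> ?s)"
      by (rule norm_blinfun)
    also have "\<dots> \<le> e * norm \<eta>"
      using assms(3)[OF clamp_Icc[OF assms(1)]] e by (intro mult_mono norm_bounded) auto
    finally show "norm (((nemytskii_deriv T f' Y1 - nemytskii_deriv T f' Y2) \<eta>) s) \<le> e * norm \<eta>" .
  qed
qed

text \<open>
  The image of \<open>Y\<close> is compact, hence a path uniformly close to \<open>Y\<close> has values at which \<open>f'\<close> is uniformly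
  close to its values along \<open>Y\<close>.
\<close>

lemma continuous_nemytskii_deriv:
  fixes f' :: "'a::real_normed_vector \<Rightarrow> 'a \<Rightarrow>\<^sub>L 'b::real_normed_vector"
  assumes "0 \<le> T" and f': "continuous_on UNIV f'"
  shows "continuous_on UNIV (nemytskii_deriv T f')"
  unfolding continuous_on_iff
proof (intro ballI allI impI)
  fix Y :: "real \<Rightarrow>\<^sub>C 'a" and e :: real assume "0 < e"
  then obtain d where d: "0 < d"
    "\<And>x y. x \<in> Y ` {0..T} \<Longrightarrow> dist y x < d \<Longrightarrow> dist (f' y) (f' x) < e / 2"
    using uniformly_close_to_compact[OF compact_path_image f', of "e / 2" Y T] by auto
  have "dist (nemytskii_deriv T f' Y') (nemytskii_deriv T f' Y) < e" if "dist Y' Y < d" for Y'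
  proof -
    have "norm (f' (Y' s) - f' (Y s)) \<le> e / 2" if "s \<in> {0..T}" for s
      using d(2)[of "Y s" "Y' s"] that \<open>dist Y' Y < d\<close> dist_bounded[of Y' s Y]
      by (force simp: dist_norm)
    from nemytskii_deriv_diff_le[OF assms this] show ?thesis
      using \<open>0 < e\<close> by (simp add: dist_norm)
  qed
  then show "\<exists>d>0. \<forall>Y'\<in>UNIV. dist Y' Y < d \<longrightarrow> dist (nemytskii_deriv T f' Y') (nemytskii_deriv T f' Y) < e"
    using d(1) by blast
qed

text \<open>
  The mean value inequality bounds the pointwise remainder by the oscillation of \<open>f'\<close> near the compact
  image of \<open>Y\<close>, uniformly in time; the supremum norm asks for exactly this uniformity.
\<close>

lemma nemytskii_has_derivative:
  fixes f :: "'a::real_normed_vector \<Rightarrow> 'b::real_normed_vector"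
  assumes "0 \<le> T" and f: "\<And>x. (f has_derivative blinfun_apply (f' x)) (at x)"
    and f': "continuous_on UNIV f'"
  shows "(nemytskii T f has_derivative blinfun_apply (nemytskii_deriv T f' Y)) (at Y)"
  unfolding has_derivative_at_alt
proof (intro conjI allI impI)
  show "bounded_linear (nemytskii_deriv T f' Y)" by (rule blinfun.bounded_linear_right)
  have cont: "continuous_on UNIV f"
    by (rule has_derivative_continuous_on) (rule f[THEN has_derivative_at_withinI])
  fix e :: real assume "0 < e"
  then obtain d where d: "0 < d"
    "\<And>x y. x \<in> Y ` {0..T} \<Longrightarrow> dist y x < d \<Longrightarrow> dist (f' y) (f' x) < e"
    using uniformly_close_to_compact[OF compact_path_image f', of e Y T] by auto
  have "norm (nemytskii T f Y' - nemytskii T f Y - nemytskii_deriv T f' Y (Y' - Y)) \<le> e * norm (Y' - Y)"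
    if close: "norm (Y' - Y) < d" for Y'
  proof (rule norm_bound)
    fix s
    define u v where "u = Y (clamp 0 T s)" and "v = Y' (clamp 0 T s)"
    have u: "u \<in> Y ` {0..T}"
      unfolding u_def using clamp_Icc[OF \<open>0 \<le> T\<close>] by blast
    have uv: "norm (v - u) \<le> norm (Y' - Y)"
      using norm_bounded[of "Y' - Y" "clamp 0 T s"] by (simp add: u_def v_def)
    have "norm (f v - f u - f' u (v - u)) \<le> norm (v - u) * e"
    proof (rule differentiable_bound_linearization[where S = "ball u d"])
      show "u + t *\<^sub>R (v - u) \<in> ball u d" if "t \<in> {0..1}" for t
      proof -
        have "t * norm (v - u) \<le> 1 * norm (v - u)"
          using that by (intro mult_right_mono) auto
        then show ?thesis using that uv close by (simp add: dist_norm)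
      qed
      show "(f has_derivative f' x) (at x within ball u d)" for x
        using f has_derivative_at_withinI by blast
      show "onorm (blinfun_apply (f' x) - blinfun_apply (f' u)) \<le> e" if "x \<in> ball u d" for x
        using d(2)[OF u, of x] that
        by (simp add: dist_norm norm_minus_commute norm_blinfun.rep_eq minus_blinfun.rep_eq
            fun_diff_def less_imp_le)
    qed (use d(1) in auto)
    also have "\<dots> \<le> e * norm (Y' - Y)"
      using uv \<open>0 < e\<close> by simp
    finally show "norm ((nemytskii T f Y' - nemytskii T f Y - nemytskii_deriv T f' Y (Y' - Y)) s) \<le> e * norm (Y' - Y)"
      by (simp add: nemytskii_apply[OF cont] nemytskii_deriv_apply[OF \<open>0 \<le> T\<close> f'] u_def v_def)
  qed
  then show "\<exists>d>0. \<forall>Y'. norm (Y' - Y) < d \<longrightarrow>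
      norm (nemytskii T f Y' - nemytskii T f Y - nemytskii_deriv T f' Y (Y' - Y)) \<le> e * norm (Y' - Y)"
    using d(1) by blast
qed

definition primitive :: "real \<Rightarrow> (real \<Rightarrow>\<^sub>C 'h) \<Rightarrow>\<^sub>L (real \<Rightarrow>\<^sub>C 'h::{real_inner, complete_space})"
  where "primitive T = Blinfun (\<lambda>z :: real \<Rightarrow>\<^sub>C 'h. clamped_path T (\<lambda>s. vintegral 0 s z))"

lemma vintegral_path_diff_le:
  fixes z :: "real \<Rightarrow>\<^sub>C 'h::{real_inner, complete_space}"
  assumes "r \<ge> 0" "s \<ge> 0"
  shows "norm (vintegral 0 r z - vintegral 0 s z) \<le> \<bar>r - s\<bar> * norm z"
proof -
  have "norm (vintegral 0 r z - vintegral 0 s z) \<le> \<bar>r - s\<bar> * norm z" if "0 \<le> s" "s \<le> r" for r s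
    using vintegral_diff_bound[of 0 s r r z "norm z"] that norm_bounded[of z]
    by (simp add: mult.commute)
  from this[of r s] this[of s r] assms show ?thesis
    by (cases "s \<le> r") (auto simp: norm_minus_commute abs_minus_commute)
qed

lemma primitive_apply:
  fixes z :: "real \<Rightarrow>\<^sub>C 'h::{real_inner, complete_space}"
  assumes "0 \<le> T"
  shows "primitive T z s = vintegral 0 (clamp 0 T s) z"
proof -
  define P where "P z = clamped_path T (\<lambda>s. vintegral 0 s z)" for z :: "real \<Rightarrow>\<^sub>C 'h"
  have P: "P z s = vintegral 0 (clamp 0 T s) z" for z s
    unfolding P_def
    by (intro clamped_path_apply continuous_on_vector_derivative[OF vintegral_has_vector_derivative]) auto
  have "norm (P z) \<le> norm z * T" for z
  proof (rule norm_bound)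
    fix s
    have "norm (P z s) \<le> clamp 0 T s * norm z"
      using vintegral_path_diff_le[of "clamp 0 T s" 0 z] clamp_Icc[OF assms, of s] by (simp add: P)
    also have "\<dots> \<le> T * norm z"
      using clamp_Icc[OF assms, of s] by (intro mult_right_mono) auto
    finally show "norm (P z s) \<le> norm z * T" by (simp add: mult.commute)
  qed
  then have "bounded_linear P"
    by (intro bounded_linear_intro[where K = T] bcontfun_eqI)
      (simp_all add: P vintegral_add vintegral_scaleR)
  then show ?thesis
    unfolding primitive_def by (simp add: bounded_linear_Blinfun_apply P flip: P_def)
qed

lemma primitive_diff_le:
  assumes "0 \<le> T"
  shows "norm (primitive T z r - primitive T z s) \<le> \<bar>r - s\<bar> * norm z"
    and "norm (primitive T z r - primitive T z s) \<le> T * norm z"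
proof -
  have *: "norm (primitive T z r - primitive T z s) \<le> \<bar>clamp 0 T r - clamp 0 T s\<bar> * norm z"
    using vintegral_path_diff_le[of "clamp 0 T r" "clamp 0 T s" z] clamp_Icc[OF assms]
    by (simp add: primitive_apply[OF assms])
  also have "\<dots> \<le> \<bar>r - s\<bar> * norm z"
    by (intro mult_right_mono abs_clamp_diff_le) auto
  finally show "norm (primitive T z r - primitive T z s) \<le> \<bar>r - s\<bar> * norm z" .
  have "\<bar>clamp 0 T r - clamp 0 T s\<bar> \<le> T"
    using clamp_Icc[OF assms, of r] clamp_Icc[OF assms, of s] by auto
  then show "norm (primitive T z r - primitive T z s) \<le> T * norm z"
    using * by (meson mult_right_mono norm_ge_zero order_trans)
qed

lemma primitive_has_vector_derivative:
  assumes "s \<in> {0..T}"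
  shows "(primitive T z has_vector_derivative z s) (at s within {0..T})"
proof (rule has_vector_derivative_transform[OF assms])
  show "((\<lambda>r. vintegral 0 r z) has_vector_derivative z s) (at s within {0..T})"
    using assms by (intro vintegral_has_vector_derivative) auto
  show "primitive T z r = vintegral 0 r z" if "r \<in> {0..T}" for r
    using that assms by (simp add: primitive_apply clamp_Icc_id)
qed

definition eval_at :: "real \<Rightarrow> (real \<Rightarrow>\<^sub>C 'b) \<Rightarrow>\<^sub>L 'b::real_normed_vector"
  where "eval_at s = Blinfun (\<lambda>z :: real \<Rightarrow>\<^sub>C 'b. z s)"

lemma eval_at_apply [simp]: "eval_at s z = z s"
  unfolding eval_at_def
  by (subst bounded_linear_Blinfun_apply)
    (auto intro!: bounded_linear_intro[where K = 1] simp: norm_bounded)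

definition constant_path :: "'b::real_normed_vector \<Rightarrow>\<^sub>L (real \<Rightarrow>\<^sub>C 'b)"
  where "constant_path = Blinfun const_bcontfun"

lemma constant_path_apply [simp]: "constant_path v s = (v :: 'b::real_normed_vector)"
proof -
  have "bounded_linear (const_bcontfun :: 'b \<Rightarrow> real \<Rightarrow>\<^sub>C 'b)"
    by (intro bounded_linear_intro[where K = 1] bcontfun_eqI) (auto intro!: norm_bound)
  then show ?thesis
    unfolding constant_path_def by (simp add: bounded_linear_Blinfun_apply)
qed

text \<open>
  The evaluation \<open>eval_at t\<close> alone is not norm-continuous in \<open>t\<close>; after integration it is Lipschitz.
\<close>

lemma continuous_eval_primitive:
  assumes "0 \<le> T"
  shows "continuous_on UNIV (\<lambda>t. eval_at t o\<^sub>L primitive T)"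
proof (rule lipschitz_on_continuous_on[where L = 1], rule lipschitz_onI)
  fix r s :: real
  show "dist (eval_at r o\<^sub>L primitive T) (eval_at s o\<^sub>L primitive T :: (real \<Rightarrow>\<^sub>C 'a) \<Rightarrow>\<^sub>L 'a) \<le> 1 * dist r s"
    unfolding dist_norm
    using primitive_diff_le(1)[OF assms]
    by (intro norm_blinfun_bound) (auto simp: blinfun.diff_left)
qed simp

section \<open>The characteristic system as a fixed-point problem\<close>

text \<open>
  In the application \<open>f\<close> and \<open>g\<close> are the gradients of the running and of the terminal functional.
\<close>

locale characteristics =
  fixes f g :: "'h::{real_inner, complete_space} \<Rightarrow> 'h"
    and f' g' :: "'h \<Rightarrow> 'h \<Rightarrow>\<^sub>L 'h"
    and c T lam :: real
  assumes T_pos: "0 < T"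
    and f_deriv: "\<And>x. (f has_derivative blinfun_apply (f' x)) (at x)"
    and f'_cont: "continuous_on UNIV f'"
    and g_deriv: "\<And>x. (g has_derivative blinfun_apply (g' x)) (at x)"
    and g'_cont: "continuous_on UNIV g'"
    and f_lipschitz: "\<And>x y. norm (f x - f y) \<le> c * norm (x - y)"
    and g_lipschitz: "\<And>x y. norm (g x - g y) \<le> c * norm (x - y)"
    and f_zero: "norm (f 0) \<le> c"
    and g_zero: "norm (g 0) \<le> c"
    and lam_large: "c * T * (1 + T) < lam"
begin

lemma c_nonneg: "0 \<le> c"
  using norm_ge_zero f_zero by (rule order_trans)

lemma lam_pos: "0 < lam"
  using lam_large c_nonneg T_pos by (smt (verit) mult_nonneg_nonneg)

lemma f_cont: "continuous_on UNIV f"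
  by (rule has_derivative_continuous_on) (rule f_deriv[THEN has_derivative_at_withinI])

lemma T_nonneg: "0 \<le> T"
  using T_pos by simp

text \<open>
  \<open>costate_of Y s\<close> is \<open>g (Y T)\<close> plus the integral of \<open>f (Y r)\<close> over \<open>{s..T}\<close>, the value that a
  solution of the equation takes at \<open>Y s\<close> when \<open>Y\<close> is one of its characteristics.
\<close>

definition costate_of :: "(real \<Rightarrow>\<^sub>C 'h) \<Rightarrow> real \<Rightarrow>\<^sub>C 'h"
  where "costate_of Y = constant_path (g (Y T) + primitive T (nemytskii T f Y) T)
    - primitive T (nemytskii T f Y)"

definition costate_deriv :: "(real \<Rightarrow>\<^sub>C 'h) \<Rightarrow> (real \<Rightarrow>\<^sub>C 'h) \<Rightarrow>\<^sub>L (real \<Rightarrow>\<^sub>C 'h)"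
  where "costate_deriv Y =
    (constant_path o\<^sub>L ((g' (eval_at T Y) o\<^sub>L eval_at T) + ((eval_at T o\<^sub>L primitive T) o\<^sub>L nemytskii_deriv T f' Y)))
    - (primitive T o\<^sub>L nemytskii_deriv T f' Y)"

text \<open>
  \<open>drift t z s\<close> is \<open>- 1 / lam\<close> times the integral of \<open>z\<close> from \<open>t\<close> to \<open>s\<close>, that is, for times in
  \<open>{0..T}\<close>, the displacement of the trajectory from its position at time \<open>t\<close>.
\<close>

definition drift :: "real \<Rightarrow> (real \<Rightarrow>\<^sub>C 'h) \<Rightarrow>\<^sub>L (real \<Rightarrow>\<^sub>C 'h)"
  where "drift t = (- 1 / lam) *\<^sub>R (primitive T - (constant_path o\<^sub>L (eval_at t o\<^sub>L primitive T)))"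

lemma drift_apply: "drift t z s = (- 1 / lam) *\<^sub>R (primitive T z s - primitive T z t)"
  by (simp add: drift_def blinfun.scaleR_left blinfun.diff_left blinfun.minus_left)

lemma drift_norm: "norm (drift t) \<le> T / lam"
proof (intro norm_blinfun_bound norm_bound)
  fix z s
  have "norm (drift t z s) = norm (primitive T z s - primitive T z t) / lam"
    using lam_pos by (simp add: drift_apply)
  then show "norm (drift t z s) \<le> T / lam * norm z"
    using primitive_diff_le(2)[OF T_nonneg, of z s t] lam_pos
    by (simp add: divide_right_mono)
qed (use T_nonneg lam_pos in simp)

lemma drift_cont: "continuous_on UNIV drift"
  unfolding drift_def by (intro continuous_intros continuous_eval_primitive T_nonneg)

lemma costate_of_apply:
  "costate_of Y s = g (Y T) + (primitive T (nemytskii T f Y) T - primitive T (nemytskii T f Y) s)"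
  by (simp add: costate_of_def)

lemma costate_of_has_derivative:
  "(costate_of has_derivative blinfun_apply (costate_deriv Y)) (at Y)"
proof -
  have "((\<lambda>Y. g (eval_at T Y)) has_derivative (\<lambda>\<eta>. g' (eval_at T Y) (eval_at T \<eta>))) (at Y)"
    by (rule has_derivative_compose[OF _ g_deriv])
      (rule bounded_linear_imp_has_derivative[OF blinfun.bounded_linear_right])
  then have "(costate_of has_derivative (\<lambda>\<eta>. constant_path (g' (eval_at T Y) (eval_at T \<eta>)
      + eval_at T (primitive T (nemytskii_deriv T f' Y \<eta>))) - primitive T (nemytskii_deriv T f' Y \<eta>))) (at Y)"
    unfolding costate_of_def[abs_def] eval_at_apply[symmetric]
    by (intro has_derivative_diff has_derivative_add
        bounded_linear.has_derivative[OF blinfun.bounded_linear_right]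
        nemytskii_has_derivative[OF T_nonneg f_deriv f'_cont])
  then show ?thesis
    by (rule has_derivative_eq_rhs)
      (auto simp: costate_deriv_def blinfun.bilinear_simps simp del: eval_at_apply)
qed

lemma continuous_costate_deriv: "continuous_on UNIV costate_deriv"
  unfolding costate_deriv_def
  by (intro continuous_intros continuous_nemytskii_deriv T_nonneg f'_cont
      continuous_on_compose2[OF g'_cont]) auto

lemma continuous_costate_of: "continuous_on UNIV costate_of"
  by (rule has_derivative_continuous_on) (rule costate_of_has_derivative[THEN has_derivative_at_withinI])

lemma costate_of_lipschitz:
  "norm (costate_of Y1 - costate_of Y2) \<le> c * (1 + T) * norm (Y1 - Y2)"
proof (rule norm_bound)
  fix s
  let ?w = "nemytskii T f Y1 - nemytskii T f Y2"
  have w: "norm ?w \<le> c * norm (Y1 - Y2)"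
  proof (rule norm_bound)
    fix s
    have "norm (?w s) \<le> c * norm ((Y1 - Y2) (clamp 0 T s))"
      using f_lipschitz by (simp add: nemytskii_apply[OF f_cont])
    also have "\<dots> \<le> c * norm (Y1 - Y2)"
      by (intro mult_left_mono norm_bounded c_nonneg)
    finally show "norm (?w s) \<le> c * norm (Y1 - Y2)" .
  qed
  have "norm (g (Y1 T) - g (Y2 T)) \<le> c * norm ((Y1 - Y2) T)"
    using g_lipschitz by simp
  also have "\<dots> \<le> c * norm (Y1 - Y2)"
    by (intro mult_left_mono norm_bounded c_nonneg)
  finally have gb: "norm (g (Y1 T) - g (Y2 T)) \<le> c * norm (Y1 - Y2)" .
  have "norm (primitive T ?w T - primitive T ?w s) \<le> T * norm ?w"
    by (rule primitive_diff_le(2)[OF T_nonneg])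
  also have "\<dots> \<le> T * (c * norm (Y1 - Y2))"
    by (intro mult_left_mono w T_nonneg)
  finally have pb: "norm (primitive T ?w T - primitive T ?w s) \<le> T * (c * norm (Y1 - Y2))" .
  have "(costate_of Y1 - costate_of Y2) s = (g (Y1 T) - g (Y2 T)) + (primitive T ?w T - primitive T ?w s)"
    by (simp add: costate_of_apply blinfun.diff_right)
  also have "norm \<dots> \<le> c * norm (Y1 - Y2) + T * (c * norm (Y1 - Y2))"
    using gb pb by (rule norm_triangle_mono)
  finally show "norm ((costate_of Y1 - costate_of Y2) s) \<le> c * (1 + T) * norm (Y1 - Y2)"
    by (simp add: algebra_simps)
qed

lemma costate_of_growth: "norm (costate_of Y) \<le> c * (1 + T) * (1 + norm Y)"
proof -
  have "norm (costate_of 0) \<le> c * (1 + T)"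
  proof (rule norm_bound)
    fix s
    have "norm (nemytskii T f 0) \<le> c"
      by (rule norm_bound) (simp add: nemytskii_apply[OF f_cont] f_zero)
    then have "norm (primitive T (nemytskii T f 0) T - primitive T (nemytskii T f 0) s) \<le> T * c"
      using primitive_diff_le(2)[OF T_nonneg] T_nonneg by (meson mult_left_mono order_trans)
    then have "norm (g 0 + (primitive T (nemytskii T f 0) T - primitive T (nemytskii T f 0) s)) \<le> c + T * c"
      by (intro norm_triangle_mono g_zero)
    then show "norm (costate_of 0 s) \<le> c * (1 + T)"
      by (simp add: costate_of_apply algebra_simps)
  qed
  moreover have "norm (costate_of Y) \<le> norm (costate_of 0) + norm (costate_of Y - costate_of 0)"
    by (rule norm_triangle_sub)
  ultimately show ?thesis
    using costate_of_lipschitz[of Y 0] by (simp add: algebra_simps)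
qed

definition contraction_factor where "contraction_factor = c * (1 + T) * (T / lam)"

lemma contraction_factor: "0 \<le> contraction_factor" "contraction_factor < 1"
  using lam_large c_nonneg T_pos lam_pos
  by (auto simp: contraction_factor_def field_simps)

lemma costate_deriv_norm: "norm (costate_deriv Y) \<le> c * (1 + T)"
  using c_nonneg T_nonneg
  by (intro derivative_norm_le_lipschitz[OF costate_of_has_derivative costate_of_lipschitz]) simp

definition trajectory :: "'h \<Rightarrow> real \<Rightarrow> (real \<Rightarrow>\<^sub>C 'h) \<Rightarrow> real \<Rightarrow>\<^sub>C 'h"
  where "trajectory X t z = constant_path X + drift t z"

lemma trajectory_apply:
  "trajectory X t z s = X - (1 / lam) *\<^sub>R (primitive T z s - primitive T z t)"
  by (simp add: trajectory_def drift_apply)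

lemma drift_diff_norm: "norm (drift t x - drift t y) \<le> T / lam * norm (x - y)"
  using order_trans[OF norm_blinfun mult_right_mono[OF drift_norm norm_ge_zero], of t "x - y"]
  by (simp add: blinfun.diff_right)

lemma costate_contraction:
  "dist (costate_of (trajectory X t x)) (costate_of (trajectory X t y)) \<le> contraction_factor * dist x y"
proof -
  have "dist (costate_of (trajectory X t x)) (costate_of (trajectory X t y))
      \<le> c * (1 + T) * norm (drift t x - drift t y)"
    using costate_of_lipschitz[of "trajectory X t x" "trajectory X t y"]
    by (simp add: dist_norm trajectory_def)
  also have "\<dots> \<le> c * (1 + T) * (T / lam * norm (x - y))"
    using c_nonneg T_nonneg by (intro mult_left_mono drift_diff_norm) auto
  finally show ?thesis by (simp add: contraction_factor_def dist_norm)
qed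

definition costate :: "'h \<Rightarrow> real \<Rightarrow> real \<Rightarrow>\<^sub>C 'h"
  where "costate X t = (THE z. costate_of (trajectory X t z) = z)"

lemma costate_ex1: "\<exists>!z. costate_of (trajectory X t z) = z"
  using costate_contraction contraction_factor by (intro banach_fix_type) auto

lemma costate_fixed: "costate_of (trajectory X t (costate X t)) = costate X t"
  unfolding costate_def by (rule theI'[OF costate_ex1])

lemma costate_eqI: "costate_of (trajectory X t z) = z \<Longrightarrow> costate X t = z"
  using costate_ex1 costate_fixed by blast

definition characteristic :: "'h \<Rightarrow> real \<Rightarrow> real \<Rightarrow>\<^sub>C 'h"
  where "characteristic X t = trajectory X t (costate X t)"

lemma costate_of_characteristic: "costate_of (characteristic X t) = costate X t"
  unfolding characteristic_def by (rule costate_fixed)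

lemma norm_constant_path: "norm (constant_path v) \<le> norm v"
  by (rule norm_bound) simp

text \<open>
  The left-hand side is the form in which the fixed-point argument delivers its bounds, the right-hand side
  that of the two estimates, with \<open>a = 1 + norm X\<close> and \<open>a = 1\<close>.
\<close>

lemma gain_eq: "c * (1 + T) * a / (1 - contraction_factor) = lam * (1 + T) * c * a / (lam - c * T * (T + 1))"
proof -
  have "1 - contraction_factor = (lam - c * T * (T + 1)) / lam"
    using lam_pos by (simp add: contraction_factor_def field_simps)
  then show ?thesis using lam_pos by simp
qed

text \<open>
  The bound \<open>a\<close> for the costate and the bound for the trajectory, \<open>norm X + (T / lam) * a\<close>, feed into each
  other; the part proportional to \<open>contraction_factor\<close> is absorbed on the left.
\<close>

lemma costate_growth: "norm (costate X t) \<le> c * (1 + T) * (1 + norm X) / (1 - contraction_factor)"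
proof -
  let ?z = "costate X t"
  have "norm (characteristic X t) \<le> norm X + T / lam * norm ?z"
    unfolding characteristic_def trajectory_def
    using drift_diff_norm[of t ?z 0] by (intro norm_triangle_mono norm_constant_path) simp
  then have "norm ?z \<le> c * (1 + T) * (1 + (norm X + T / lam * norm ?z))"
    using costate_of_growth[of "characteristic X t"] c_nonneg T_nonneg
    unfolding costate_of_characteristic
    by (elim order_trans) (intro mult_left_mono, auto)
  then have "(1 - contraction_factor) * norm ?z \<le> c * (1 + T) * (1 + norm X)"
    by (simp add: contraction_factor_def algebra_simps add_divide_distrib)
  then show ?thesis using contraction_factor by (simp add: field_simps)
qed

lemma costate_lipschitz:
  "norm (costate X1 t - costate X2 t) \<le> c * (1 + T) / (1 - contraction_factor) * norm (X1 - X2)"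
proof -
  let ?z1 = "costate X1 t" and ?z2 = "costate X2 t"
  have "characteristic X1 t - characteristic X2 t = constant_path (X1 - X2) + (drift t ?z1 - drift t ?z2)"
    by (simp add: characteristic_def trajectory_def blinfun.diff_right)
  also have "norm \<dots> \<le> norm (X1 - X2) + T / lam * norm (?z1 - ?z2)"
    by (intro norm_triangle_mono norm_constant_path drift_diff_norm)
  finally have "norm (?z1 - ?z2) \<le> c * (1 + T) * (norm (X1 - X2) + T / lam * norm (?z1 - ?z2))"
    using costate_of_lipschitz[of "characteristic X1 t" "characteristic X2 t"] c_nonneg T_nonneg
    unfolding costate_of_characteristic
    by (elim order_trans) (intro mult_left_mono, auto)
  then have "(1 - contraction_factor) * norm (?z1 - ?z2) \<le> c * (1 + T) * norm (X1 - X2)"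
    by (simp add: contraction_factor_def algebra_simps add_divide_distrib)
  then show ?thesis using contraction_factor by (simp add: field_simps)
qed

lemma costate_continuous: "continuous_on UNIV (\<lambda>(X, t). costate X t)"
proof (rule fixed_point_continuous[where \<Gamma> = "\<lambda>(X, t) z. costate_of (trajectory X t z)"])
  show "continuous_on UNIV (\<lambda>p. (case p of (X, t) \<Rightarrow> \<lambda>z. costate_of (trajectory X t z)) z)" for z
    unfolding case_prod_beta trajectory_def
    by (intro continuous_on_compose2[OF continuous_costate_of] continuous_intros
        continuous_on_compose2[OF drift_cont]) auto
qed (use costate_contraction contraction_factor(2) costate_fixed in auto)

lemma characteristic_continuous: "continuous_on UNIV (\<lambda>(X, t). characteristic X t)"
  using costate_continuous
  unfolding case_prod_beta characteristic_def trajectory_def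
  by (intro continuous_intros continuous_on_compose2[OF drift_cont]) auto

section \<open>Dependence on the initial position\<close>

text \<open>
  The derivative of \<open>costate\<close> in its first argument, described by the linearised fixed-point equation
  that it must satisfy.
\<close>

definition costate_sensitivity :: "'h \<Rightarrow> real \<Rightarrow> 'h \<Rightarrow>\<^sub>L (real \<Rightarrow>\<^sub>C 'h)"
  where "costate_sensitivity X t = (SOME L.
    L = costate_deriv (characteristic X t) o\<^sub>L (constant_path + (drift t o\<^sub>L L)))"

lemma norm_deriv_drift: "norm (costate_deriv Y o\<^sub>L drift t) \<le> contraction_factor"
proof -
  have "norm (costate_deriv Y o\<^sub>L drift t) \<le> norm (costate_deriv Y) * norm (drift t)"
    by (rule norm_blinfun_compose)
  also have "\<dots> \<le> c * (1 + T) * (T / lam)"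
    using c_nonneg T_nonneg by (intro mult_mono costate_deriv_norm drift_norm) auto
  finally show ?thesis by (simp add: contraction_factor_def)
qed

lemma compose_split:
  "D o\<^sub>L (C + (S o\<^sub>L L)) = (D o\<^sub>L C) + ((D o\<^sub>L S) o\<^sub>L L)"
  by (rule blinfun_eqI) (simp add: blinfun.bilinear_simps)

lemma costate_sensitivity:
  "costate_sensitivity X t =
    costate_deriv (characteristic X t) o\<^sub>L (constant_path + (drift t o\<^sub>L costate_sensitivity X t))"
proof -
  let ?D = "costate_deriv (characteristic X t)"
  have "norm (?D o\<^sub>L drift t) < 1"
    using norm_deriv_drift contraction_factor(2) by (rule le_less_trans)
  then obtain L where "L = (?D o\<^sub>L constant_path) + ((?D o\<^sub>L drift t) o\<^sub>L L)"
    by (rule resolvent_exists)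
  then have "\<exists>L. L = ?D o\<^sub>L (constant_path + (drift t o\<^sub>L L))"
    unfolding compose_split by blast
  then show ?thesis
    unfolding costate_sensitivity_def by (rule someI_ex)
qed

text \<open>
  With \<open>D\<close> the derivative of \<open>costate_of\<close> at the characteristic, the chain rule yields the partial derivatives
  \<open>D o constant_path\<close> in \<open>X\<close> and \<open>D o drift t\<close> in the path; the second has norm at most
  \<open>contraction_factor\<close>, so the implicit differentiation of the fixed point is justified.
\<close>

lemma costate_has_derivative:
  "((\<lambda>X. costate X t) has_derivative blinfun_apply (costate_sensitivity X t)) (at X)"
proof (rule fixed_point_has_derivative)
  let ?D = "costate_deriv (characteristic X t)"
  have "((\<lambda>(x, z). trajectory x t z) has_derivative (\<lambda>(\<xi>, \<zeta>). constant_path \<xi> + drift t \<zeta>)) (at (X, costate X t))"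
    unfolding trajectory_def case_prod_beta
    by (intro derivative_eq_intros bounded_linear.has_derivative[OF blinfun.bounded_linear_right])
      (auto intro!: derivative_eq_intros bounded_linear.has_derivative[OF blinfun.bounded_linear_right])
  from has_derivative_compose[OF this, of costate_of ?D]
  show "((\<lambda>(x, z). costate_of (trajectory x t z)) has_derivative
      (\<lambda>(\<xi>, \<zeta>). (?D o\<^sub>L constant_path) \<xi> + (?D o\<^sub>L drift t) \<zeta>)) (at (X, costate X t))"
    using costate_of_has_derivative[of "characteristic X t"]
    by (simp add: case_prod_beta' characteristic_def blinfun.add_right)
  show "costate_of (trajectory x t (costate x t)) = costate x t" for x
    by (rule costate_fixed)
  show "norm (costate x t - costate X t) \<le> c * (1 + T) / (1 - contraction_factor) * norm (x - X)" for x
    by (rule costate_lipschitz)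
  show "norm (?D o\<^sub>L drift t) < 1"
    using norm_deriv_drift contraction_factor(2) by (rule le_less_trans)
  show "costate_sensitivity X t \<xi> =
      (?D o\<^sub>L constant_path) \<xi> + (?D o\<^sub>L drift t) (costate_sensitivity X t \<xi>)" for \<xi>
    using arg_cong[OF costate_sensitivity[of X t, unfolded compose_split], of "\<lambda>L. blinfun_apply L \<xi>"]
    by (simp add: blinfun.add_left)
qed

lemma costate_deriv_characteristic_continuous:
  "continuous_on UNIV (\<lambda>p. costate_deriv (characteristic (fst p) (snd p)))"
  using characteristic_continuous
  by (intro continuous_on_compose2[OF continuous_costate_deriv]) (auto simp: case_prod_beta)

lemma costate_sensitivity_continuous:
  "continuous_on UNIV (\<lambda>p. costate_sensitivity (fst p) (snd p))"
proof (rule fixed_point_continuous[where \<theta> = contraction_factor and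
      \<Gamma> = "\<lambda>p L. costate_deriv (characteristic (fst p) (snd p)) o\<^sub>L (constant_path + (drift (snd p) o\<^sub>L L))"])
  fix p :: "'h \<times> real" and L M :: "'h \<Rightarrow>\<^sub>L (real \<Rightarrow>\<^sub>C 'h)"
  let ?D = "costate_deriv (characteristic (fst p) (snd p))" and ?S = "drift (snd p)"
  have "(?D o\<^sub>L (constant_path + (?S o\<^sub>L L))) - (?D o\<^sub>L (constant_path + (?S o\<^sub>L M))) = (?D o\<^sub>L ?S) o\<^sub>L (L - M)"
    by (rule blinfun_eqI) (simp add: blinfun.bilinear_simps)
  also have "norm \<dots> \<le> contraction_factor * norm (L - M)"
    by (intro order_trans[OF norm_blinfun_compose] mult_right_mono norm_deriv_drift norm_ge_zero)
  finally show "dist (?D o\<^sub>L (constant_path + (?S o\<^sub>L L))) (?D o\<^sub>L (constant_path + (?S o\<^sub>L M)))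
      \<le> contraction_factor * dist L M"
    by (simp add: dist_norm)
qed (use contraction_factor(2) costate_sensitivity[symmetric] in \<open>auto intro!: continuous_intros
      costate_deriv_characteristic_continuous continuous_on_compose2[OF drift_cont]\<close>)

definition solution :: "'h \<Rightarrow> real \<Rightarrow> 'h"
  where "solution X t = costate X t t"

definition solution_deriv :: "'h \<Rightarrow> real \<Rightarrow> 'h \<Rightarrow>\<^sub>L 'h"
  where "solution_deriv X t = eval_at t o\<^sub>L costate_sensitivity X t"

lemma solution_has_derivative:
  "((\<lambda>X. solution X t) has_derivative blinfun_apply (solution_deriv X t)) (at X)"
  using bounded_linear.has_derivative[OF blinfun.bounded_linear_right[of "eval_at t"] costate_has_derivative[of t X]]
  by (simp add: solution_def solution_deriv_def blinfun_compose.rep_eq comp_def)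

lemma solution_deriv_norm: "norm (solution_deriv X t) \<le> c * (1 + T) / (1 - contraction_factor)"
proof (rule derivative_norm_le_lipschitz[OF solution_has_derivative])
  fix Y
  have "norm (solution Y t - solution X t) \<le> norm (costate Y t - costate X t)"
    unfolding solution_def using norm_bounded[of "costate Y t - costate X t" t] by simp
  then show "norm (solution Y t - solution X t) \<le> c * (1 + T) / (1 - contraction_factor) * norm (Y - X)"
    using costate_lipschitz by (rule order_trans)
qed (use c_nonneg T_nonneg contraction_factor in simp)

text \<open>
  Evaluation at the moving time \<open>t\<close> is not norm-continuous, so continuity of \<open>costate_sensitivity\<close> is not
  enough. The linearised equation exhibits the sensitivity as an image under \<open>costate_deriv\<close>, where
  the evaluation at \<open>t\<close> acts on a primitive.
\<close>

lemma solution_deriv_continuous: "continuous_on UNIV (\<lambda>p. solution_deriv (fst p) (snd p))"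
proof -
  \<comment> \<open>the constant part of \<open>costate_deriv\<close> ignores \<open>t\<close>; what remains is \<open>eval_at t o\<^sub>L primitive T\<close>\<close>
  have eval: "eval_at t o\<^sub>L costate_deriv Y = (g' (eval_at T Y) o\<^sub>L eval_at T)
      + (((eval_at T o\<^sub>L primitive T) - (eval_at t o\<^sub>L primitive T)) o\<^sub>L nemytskii_deriv T f' Y)" for t Y
    by (rule blinfun_eqI) (simp add: costate_deriv_def blinfun.bilinear_simps)
  have "solution_deriv X t = (eval_at t o\<^sub>L costate_deriv (characteristic X t))
      o\<^sub>L (constant_path + (drift t o\<^sub>L costate_sensitivity X t))" for X t
    unfolding solution_deriv_def
    by (subst costate_sensitivity) (rule blinfun_eqI, simp)
  then show ?thesis
    using characteristic_continuous unfolding eval case_prod_beta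
    by (auto intro!: continuous_intros costate_sensitivity_continuous
        continuous_on_compose2[OF drift_cont] continuous_on_compose2[OF g'_cont]
        continuous_on_compose2[OF continuous_eval_primitive[OF T_nonneg]]
        continuous_on_compose2[OF continuous_nemytskii_deriv[OF T_nonneg f'_cont]]
        simp del: eval_at_apply)
qed

end

section \<open>The equation along the characteristics\<close>

text \<open>
  The two slices of \<open>UNIV \<times> {0..T}\<close> through a point determine the operators of the equation. Since
  \<open>0 < T\<close>, the time derivative is unique at the end points too, where it is one-sided.
\<close>

lemma partial_derivatives:
  fixes U :: "'h::real_normed_vector \<Rightarrow> real \<Rightarrow> 'h"
  assumes U: "((\<lambda>(X, t). U X t) has_derivative U') (at (X, t) within UNIV \<times> {0..T})"
    and t: "t \<in> {0..T}" and "0 < T"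
  shows "D_X U X t = (\<lambda>\<xi>. U' (\<xi>, 0))" and "D_t T U X t = U' (0, 1)"
proof -
  have "((\<lambda>Y. (Y, t)) has_derivative (\<lambda>\<xi>. (\<xi>, 0))) (at X)"
    by (auto intro!: derivative_eq_intros)
  moreover have "((\<lambda>(X, t). U X t) has_derivative U') (at (X, t) within (range (\<lambda>Y. (Y, t))))"
    using t by (intro has_derivative_subset[OF U]) auto
  ultimately have "((\<lambda>Y. U Y t) has_derivative (\<lambda>\<xi>. U' (\<xi>, 0))) (at X)"
    using has_derivative_in_compose[of "\<lambda>Y. (Y, t)" "\<lambda>\<xi>. (\<xi>, 0)" X UNIV "\<lambda>(X, t). U X t" U'] by simp
  then show "D_X U X t = (\<lambda>\<xi>. U' (\<xi>, 0))"
    unfolding D_X_def by (rule frechet_derivative_at[symmetric])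
  have "((\<lambda>s. (X, s)) has_derivative (\<lambda>\<tau>. (0, \<tau>))) (at t within {0..T})"
    by (auto intro!: derivative_eq_intros)
  moreover have "((\<lambda>(X, t). U X t) has_derivative U') (at (X, t) within ((\<lambda>s. (X, s)) ` {0..T}))"
    by (intro has_derivative_subset[OF U]) auto
  ultimately have deriv: "((\<lambda>s. U X s) has_derivative (\<lambda>\<tau>. U' (0, \<tau>))) (at t within {0..T})"
    using has_derivative_in_compose[of "\<lambda>s. (X, s)" "\<lambda>\<tau>. (0, \<tau>)" t "{0..T}" "\<lambda>(X, t). U X t" U'] by simp
  have "(\<lambda>\<tau>. U' (0, \<tau>)) = (\<lambda>\<tau>. \<tau> *\<^sub>R U' (0, 1))"
  proof
    show "U' (0, \<tau>) = \<tau> *\<^sub>R U' (0, 1)" for \<tau>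
      using linear_scale[OF bounded_linear.linear[OF has_derivative_bounded_linear[OF U]], of \<tau> "(0, 1)"] by simp
  qed
  with deriv have "((\<lambda>s. U X s) has_vector_derivative U' (0, 1)) (at t within {0..T})"
    unfolding has_vector_derivative_def by (rule has_derivative_eq_rhs)
  then show "D_t T U X t = U' (0, 1)"
    unfolding D_t_def using vector_derivative_within_cbox[OF \<open>0 < T\<close>] t by auto
qed

context characteristics
begin

lemma characteristic_apply:
  "characteristic X t s = X - (1 / lam) *\<^sub>R (primitive T (costate X t) s - primitive T (costate X t) t)"
  unfolding characteristic_def by (rule trajectory_apply)

lemma characteristic_start [simp]: "characteristic X t t = X"
  by (simp add: characteristic_apply)

text \<open>
  Moving the base point along the characteristic changes neither the trajectory nor the costate: the two
  integrals from \<open>t\<close> to \<open>s\<close> cancel, so \<open>costate X t\<close> also solves the fixed-point problem based at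
  \<open>(characteristic X t s, s)\<close>.
\<close>

lemma costate_flow: "costate (characteristic X t s) s = costate X t"
proof (rule costate_eqI)
  have "trajectory (characteristic X t s) s (costate X t) = characteristic X t"
    by (rule bcontfun_eqI) (simp add: characteristic_apply trajectory_apply scaleR_diff_right)
  then show "costate_of (trajectory (characteristic X t s) s (costate X t)) = costate X t"
    by (simp add: costate_of_characteristic)
qed

lemma solution_along_characteristic: "solution (characteristic X t s) s = costate X t s"
  unfolding solution_def costate_flow ..

lemma characteristic_has_vector_derivative:
  assumes "s \<in> {0..T}"
  shows "(characteristic X t has_vector_derivative - (1 / lam) *\<^sub>R costate X t s) (at s within {0..T})"
  unfolding characteristic_apply[abs_def]
  by (auto intro!: derivative_eq_intros primitive_has_vector_derivative[OF assms])

lemma costate_has_vector_derivative: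
  assumes "s \<in> {0..T}"
  shows "(costate X t has_vector_derivative - f (characteristic X t s)) (at s within {0..T})"
proof -
  have "(costate_of (characteristic X t) has_vector_derivative
      - (nemytskii T f (characteristic X t) s)) (at s within {0..T})"
    unfolding costate_of_apply[abs_def]
    by (auto intro!: derivative_eq_intros primitive_has_vector_derivative[OF assms])
  then show ?thesis
    by (simp add: costate_of_characteristic nemytskii_apply[OF f_cont] clamp_Icc_id[OF assms])
qed

lemma costate_terminal: "costate X t T = g (characteristic X t T)"
  using costate_of_apply[of "characteristic X t" T] by (simp add: costate_of_characteristic)

lemma solution_terminal: "solution X T = g X"
  unfolding solution_def costate_terminal by simp

lemma characteristic_displacement:
  "norm (characteristic X t s - X) \<le> norm (costate X t) / lam * \<bar>s - t\<bar>"
  using primitive_diff_le(1)[OF T_nonneg, of "costate X t" s t] lam_pos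
  by (simp add: characteristic_apply divide_right_mono mult.commute)

text \<open>
  A two-point form of differentiability in space with a remainder uniform in time. It holds because
  the derivative is continuous in \<open>(X, t)\<close> jointly.
\<close>

lemma solution_linearization:
  assumes "0 < e"
  obtains d where "0 < d"
    "\<And>Y1 Y2 s. norm (Y1 - X) < d \<Longrightarrow> norm (Y2 - X) < d \<Longrightarrow> \<bar>s - t\<bar> < d \<Longrightarrow>
      norm (solution Y1 s - solution Y2 s - solution_deriv X t (Y1 - Y2)) \<le> e * norm (Y1 - Y2)"
proof -
  obtain d where "0 < d" and d: "\<And>Y s. dist (Y, s) (X, t) < d \<Longrightarrow>
      dist (solution_deriv Y s) (solution_deriv X t) < e"
    using solution_deriv_continuous assms unfolding continuous_on_iff by fastforce
  show ?thesis
  proof (rule that[of "d / 2"])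
    fix Y1 Y2 s
    assume near: "norm (Y1 - X) < d / 2" "norm (Y2 - X) < d / 2" "\<bar>s - t\<bar> < d / 2"
    \<comment> \<open>its derivative is the oscillation of \<open>solution_deriv\<close>, below \<open>e\<close> on the ball\<close>
    define h where "h Y = solution Y s - solution_deriv X t Y" for Y
    have "norm (h Y1 - h Y2) \<le> e * norm (Y1 - Y2)"
    proof (rule differentiable_bound[where S = "ball X (d / 2)" and
          f' = "\<lambda>Y. blinfun_apply (solution_deriv Y s - solution_deriv X t)"])
      show "(h has_derivative blinfun_apply (solution_deriv Y s - solution_deriv X t)) (at Y within ball X (d / 2))" for Y
        unfolding h_def blinfun.diff_left[abs_def] minus_blinfun.rep_eq
        by (intro has_derivative_diff has_derivative_at_withinI[OF solution_has_derivative]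
            bounded_linear_imp_has_derivative blinfun.bounded_linear_right)
      show "onorm (blinfun_apply (solution_deriv Y s - solution_deriv X t)) \<le> e" if "Y \<in> ball X (d / 2)" for Y
      proof -
        have "dist (Y, s) (X, t) \<le> dist Y X + dist s t"
          using norm_Pair_le[of "Y - X" "s - t"] by (simp add: dist_norm)
        also have "\<dots> < d"
          using that near(3) by (simp add: dist_commute dist_real_def)
        finally show ?thesis
          using d[of Y s] by (simp add: dist_norm less_imp_le flip: norm_blinfun.rep_eq)
      qed
    qed (use near in \<open>auto simp: dist_norm norm_minus_commute\<close>)
    then show "norm (solution Y1 s - solution Y2 s - solution_deriv X t (Y1 - Y2)) \<le> e * norm (Y1 - Y2)"
      by (simp add: h_def blinfun.diff_right algebra_simps)
  qed (use \<open>0 < d\<close> in simp)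
qed

text \<open>
  The direction \<open>(\<xi>, \<tau>)\<close> is split into the displacement \<open>(- (\<tau> / lam) *\<^sub>R solution X t, \<tau>)\<close> along the
  characteristic, on which the solution changes by \<open>- \<tau> *\<^sub>R f X\<close>, and the remaining purely spatial one.
\<close>

definition solution_total_deriv :: "'h \<Rightarrow> real \<Rightarrow> ('h \<times> real) \<Rightarrow>\<^sub>L 'h"
  where "solution_total_deriv X t =
    (solution_deriv X t o\<^sub>L (fst_blinfun + (1 / lam) *\<^sub>R (blinfun_scaleR_left (solution X t) o\<^sub>L snd_blinfun)))
    - (blinfun_scaleR_left (f X) o\<^sub>L snd_blinfun)"

lemma solution_total_deriv_apply:
  "solution_total_deriv X t (\<xi>, \<tau>) = solution_deriv X t (\<xi> + (\<tau> / lam) *\<^sub>R solution X t) - \<tau> *\<^sub>R f X"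
  by (simp add: solution_total_deriv_def blinfun.diff_left blinfun.add_left blinfun.scaleR_left)

text \<open>
  With \<open>Y\<close> and \<open>Z\<close> the characteristic and costate through \<open>(X, t)\<close>, the flow property gives
  \<open>solution X' t' = r (X', t') + A (X' - Y t') + Z t'\<close>, where \<open>A\<close> is the derivative in space at \<open>(X, t)\<close> and
  \<open>r\<close> is the linearisation error between the two points \<open>X'\<close> and \<open>Y t'\<close>. This error is of lower order
  since both points are within a multiple of \<open>norm (X' - X, t' - t)\<close> of \<open>X\<close>.
\<close>

lemma solution_joint_derivative:
  assumes t: "t \<in> {0..T}"
  shows "((\<lambda>(X, t). solution X t) has_derivative blinfun_apply (solution_total_deriv X t))
    (at (X, t) within UNIV \<times> {0..T})" (is "(_ has_derivative _) ?at")
proof -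
  let ?Y = "characteristic X t" and ?Z = "costate X t" and ?A = "solution_deriv X t"
  have image: "snd ` (UNIV \<times> {0..T}) = {0..T}" by force
  have snd: "(snd has_derivative snd) ?at"
    by (rule bounded_linear_imp_has_derivative[OF bounded_linear_snd])
  have "(?Z has_derivative (\<lambda>\<tau>. \<tau> *\<^sub>R - f X)) (at t within {0..T})"
    using costate_has_vector_derivative[OF t, of X t] by (simp add: has_vector_derivative_def)
  then have Z: "((\<lambda>p. ?Z (snd p)) has_derivative (\<lambda>p. snd p *\<^sub>R - f X)) ?at"
    using has_derivative_in_compose[OF snd, of ?Z] by (simp add: image)
  have "(?Y has_derivative (\<lambda>\<tau>. \<tau> *\<^sub>R (- (1 / lam) *\<^sub>R solution X t))) (at t within {0..T})"
    using characteristic_has_vector_derivative[OF t, of X t]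
    by (simp add: has_vector_derivative_def solution_def)
  then have Y: "((\<lambda>p. ?Y (snd p)) has_derivative (\<lambda>p. snd p *\<^sub>R (- (1 / lam) *\<^sub>R solution X t))) ?at"
    using has_derivative_in_compose[OF snd, of ?Y] by (simp add: image)
  define r where "r p = solution (fst p) (snd p) - solution (?Y (snd p)) (snd p) - ?A (fst p - ?Y (snd p))" for p
  \<comment> \<open>\<open>norm (X' - Y t') \<le> k * norm (X' - X, t' - t)\<close>, as \<open>Y\<close> moves with speed at most \<open>norm Z / lam\<close>\<close>
  define k where "k = 1 + norm ?Z / lam"
  have k: "1 \<le> k" using lam_pos by (simp add: k_def)
  have r: "(r has_derivative (\<lambda>p. 0)) ?at"
    unfolding has_derivative_within_alt
  proof (intro conjI allI impI)
    fix e :: real assume "0 < e"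
    then have "0 < e / k" using k by simp
    then obtain d where "0 < d" and d: "\<And>Y1 Y2 s. norm (Y1 - X) < d \<Longrightarrow> norm (Y2 - X) < d \<Longrightarrow> \<bar>s - t\<bar> < d \<Longrightarrow>
        norm (solution Y1 s - solution Y2 s - ?A (Y1 - Y2)) \<le> e / k * norm (Y1 - Y2)"
      using solution_linearization[of "e / k" X t] by blast
    have "norm (r p) \<le> e * norm (p - (X, t))" if p: "norm (p - (X, t)) < d / k" for p
    proof -
      obtain X' t' where p_def: "p = (X', t')" by (cases p)
      have le: "norm (X' - X) \<le> norm (p - (X, t))" "\<bar>t' - t\<bar> \<le> norm (p - (X, t))"
        using norm_fst_le[of "X' - X" "t' - t"] norm_snd_le[of "t' - t" "X' - X"] by (simp_all add: p_def)
      have small: "k * norm (p - (X, t)) < d"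
        using p k by (simp add: field_simps)
      then have "norm (p - (X, t)) < d"
        using mult_right_mono[OF k norm_ge_zero, of "p - (X, t)"] by simp
      have Y_le: "norm (?Y t' - X) \<le> norm ?Z / lam * norm (p - (X, t))"
        using characteristic_displacement[of X t t'] le(2) lam_pos
        by (elim order_trans) (intro mult_left_mono, auto)
      also have "\<dots> \<le> k * norm (p - (X, t))"
        by (intro mult_right_mono) (auto simp: k_def)
      finally have "norm (?Y t' - X) < d" using small by simp
      have "norm (X' - ?Y t') \<le> norm (X' - X) + norm (?Y t' - X)"
        using norm_triangle_ineq4[of "X' - X" "?Y t' - X"] by simp
      also have "\<dots> \<le> k * norm (p - (X, t))"
        using le(1) Y_le by (simp add: k_def algebra_simps)
      finally have diff_le: "norm (X' - ?Y t') \<le> k * norm (p - (X, t))" .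
      have "norm (r p) \<le> e / k * norm (X' - ?Y t')"
        unfolding r_def p_def fst_conv snd_conv
        by (rule d) (use le \<open>norm (p - (X, t)) < d\<close> \<open>norm (?Y t' - X) < d\<close> in auto)
      also have "\<dots> \<le> e / k * (k * norm (p - (X, t)))"
        using diff_le \<open>0 < e / k\<close> by (intro mult_left_mono) auto
      finally show ?thesis using k by simp
    qed
    moreover have "r (X, t) = 0" by (simp add: r_def)
    ultimately show "\<exists>d>0. \<forall>p\<in>UNIV \<times> {0..T}. norm (p - (X, t)) < d \<longrightarrow>
        norm (r p - r (X, t) - 0) \<le> e * norm (p - (X, t))"
      using \<open>0 < d\<close> k by (intro exI[of _ "d / k"]) auto
  qed simp
  have "((\<lambda>p. r p + ?A (fst p - ?Y (snd p)) + ?Z (snd p)) has_derivative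
      (\<lambda>p. 0 + ?A (fst p - snd p *\<^sub>R (- (1 / lam) *\<^sub>R solution X t)) + snd p *\<^sub>R - f X)) ?at"
    by (intro has_derivative_add r Z Y bounded_linear.has_derivative[OF blinfun.bounded_linear_right]
        has_derivative_diff bounded_linear_imp_has_derivative[OF bounded_linear_fst])
  moreover have "(\<lambda>p. r p + ?A (fst p - ?Y (snd p)) + ?Z (snd p)) = (\<lambda>(X, t). solution X t)"
    by (auto simp: r_def solution_along_characteristic)
  moreover have "(\<lambda>p. 0 + ?A (fst p - snd p *\<^sub>R (- (1 / lam) *\<^sub>R solution X t)) + snd p *\<^sub>R - f X)
      = solution_total_deriv X t"
    by (auto simp: solution_total_deriv_apply)
  ultimately show ?thesis by simp
qed

lemma solution_C1: "C1_on (\<lambda>(X, t). solution X t) (UNIV \<times> {0..T})"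
  unfolding C1_on_def
proof (intro exI conjI ballI)
  let ?U' = "\<lambda>p. solution_total_deriv (fst p) (snd p)"
  show deriv: "((\<lambda>(X, t). solution X t) has_derivative blinfun_apply (?U' p)) (at p within UNIV \<times> {0..T})"
    if "p \<in> UNIV \<times> {0..T}" for p
    using solution_joint_derivative that by (cases p) auto
  have "continuous_on (UNIV \<times> {0..T}) (\<lambda>(X, t). solution X t)"
    by (rule has_derivative_continuous_on) (rule deriv)
  then have "continuous_on (UNIV \<times> {0..T}) (\<lambda>p. solution (fst p) (snd p))"
    by (simp add: case_prod_beta)
  then show "continuous_on (UNIV \<times> {0..T}) ?U'"
    unfolding solution_total_deriv_def
    by (intro continuous_intros continuous_on_subset[OF solution_deriv_continuous]
        bounded_linear.continuous_on[OF bounded_linear_blinfun_scaleR_left]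
        continuous_on_compose2[OF f_cont]) auto
qed

text \<open>
  In direction \<open>(0, 1)\<close> the total derivative is \<open>(1 / lam) *\<^sub>R D_X U U - f X\<close>: the equation is the statement
  that \<open>U\<close> changes at rate \<open>- f\<close> along its characteristics.
\<close>

lemma solution_equation:
  assumes "t \<in> {0..T}"
  shows "D_t T solution X t - (1 / lam) *\<^sub>R D_X solution X t (solution X t) + f X = 0"
    and "D_X solution X t = solution_deriv X t"
  using partial_derivatives[OF solution_joint_derivative[OF assms] assms T_pos, of X]
  by (auto simp: solution_total_deriv_apply blinfun.scaleR_right)

end

section \<open>Uniqueness\<close>

text \<open>
  The weight \<open>exp (2 * K * s)\<close> grows fast enough to make its product with \<open>w s \<bullet> w s\<close> nondecreasing in \<open>s\<close>;
  this nonnegative product vanishes at the right end point, hence everywhere before it.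
\<close>

lemma backward_gronwall:
  fixes w :: "real \<Rightarrow> 'a::real_inner"
  assumes "a \<le> b" and w: "\<And>s. s \<in> {a..b} \<Longrightarrow> (w has_vector_derivative w' s) (at s within {a..b})"
    and bound: "\<And>s. s \<in> {a..b} \<Longrightarrow> norm (w' s) \<le> K * norm (w s)"
    and "w b = 0"
  shows "w a = 0"
proof -
  define \<phi> where "\<phi> s = exp (2 * K * s) * (w s \<bullet> w s)" for s
  define \<phi>' where "\<phi>' s = 2 * exp (2 * K * s) * (K * (w s \<bullet> w s) + w s \<bullet> w' s)" for s
  have deriv: "(\<phi> has_derivative (\<lambda>h. h * \<phi>' s)) (at s within {a..b})" if "s \<in> {a..b}" for s
    unfolding \<phi>_def \<phi>'_def
    by (rule derivative_eq_intros w[OF that, unfolded has_vector_derivative_def] refl)+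
      (auto simp: fun_eq_iff inner_commute algebra_simps)
  then obtain s where s: "s \<in> {a..b}" "\<phi> b - \<phi> a = (b - a) * \<phi>' s"
    using mvt_very_simple[OF \<open>a \<le> b\<close>, of \<phi> "\<lambda>s h. h * \<phi>' s"] by auto
  have "- (w s \<bullet> w' s) \<le> norm (w s) * norm (w' s)"
    using Cauchy_Schwarz_ineq2[of "w s" "w' s"] by simp
  also have "\<dots> \<le> norm (w s) * (K * norm (w s))"
    using bound[OF s(1)] by (rule mult_left_mono) simp
  also have "\<dots> = K * (w s \<bullet> w s)"
    by (simp add: dot_square_norm power2_eq_square)
  finally have "0 \<le> \<phi>' s"
    by (simp add: \<phi>'_def)
  then have "\<phi> a \<le> \<phi> b"
    using mult_nonneg_nonneg[of "b - a" "\<phi>' s"] s(2) \<open>a \<le> b\<close> by linarith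
  then have "w a \<bullet> w a \<le> 0"
    using \<open>w b = 0\<close> by (simp add: \<phi>_def mult_le_0_iff)
  then show ?thesis by (metis inner_eq_zero_iff inner_ge_zero order_antisym)
qed

context characteristics
begin

text \<open>
  The comparison runs along characteristics of the constructed solution, which are already available, so
  no differential equation has to be solved for the competitor \<open>V\<close>.
\<close>

lemma solution_unique:
  assumes V: "\<And>X t. t \<in> {0..T} \<Longrightarrow>
      ((\<lambda>(X, t). V X t) has_derivative V' X t) (at (X, t) within UNIV \<times> {0..T})"
    and equation: "\<And>X t. t \<in> {0..T} \<Longrightarrow> D_t T V X t - (1 / lam) *\<^sub>R D_X V X t (V X t) + f X = 0"
    and terminal: "\<And>X. V X T = g X"
    and bound: "\<And>X t. t \<in> {0..T} \<Longrightarrow> onorm (D_X V X t) \<le> K"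
    and t: "t \<in> {0..T}"
  shows "V X t = solution X t"
proof -
  let ?Y = "characteristic X t" and ?Z = "costate X t"
  define w where "w s = V (?Y s) s - ?Z s" for s
  define w' where "w' s = (1 / lam) *\<^sub>R D_X V (?Y s) s (w s)" for s
  note partial = partial_derivatives[OF V _ T_pos]
  have blin: "bounded_linear (D_X V X s)" if "s \<in> {0..T}" for X s
    unfolding partial(1)[OF that that]
    by (rule bounded_linear_compose[OF has_derivative_bounded_linear[OF V[OF that]]])
      (intro bounded_linear_Pair bounded_linear_ident bounded_linear_zero)
  have w: "(w has_vector_derivative w' s) (at s within {0..T})" if s: "s \<in> {0..T}" for s
  proof -
    let ?Y' = "- (1 / lam) *\<^sub>R ?Z s"
    let ?V' = "V' (?Y s) s"
    interpret V': bounded_linear ?V'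
      using V[OF s] by (rule has_derivative_bounded_linear)
    have "((\<lambda>s. (?Y s, s)) has_derivative (\<lambda>\<tau>. \<tau> *\<^sub>R (?Y', 1))) (at s within {0..T})"
      using characteristic_has_vector_derivative[OF s, of X t]
      unfolding has_vector_derivative_def by (auto intro!: derivative_eq_intros)
    moreover have "((\<lambda>(X, t). V X t) has_derivative ?V') (at (?Y s, s) within (\<lambda>s. (?Y s, s)) ` {0..T})"
      by (rule has_derivative_subset[OF V[OF s]]) auto
    ultimately have "((\<lambda>s. V (?Y s) s) has_vector_derivative ?V' (?Y', 1)) (at s within {0..T})"
      using has_derivative_in_compose[of "\<lambda>s. (?Y s, s)" _ s "{0..T}" "\<lambda>(X, t). V X t" ?V']
      unfolding has_vector_derivative_def V'.scaleR[symmetric] by simp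
    then have "(w has_vector_derivative ?V' (?Y', 1) - - f (?Y s)) (at s within {0..T})"
      unfolding w_def by (rule has_vector_derivative_diff[OF _ costate_has_vector_derivative[OF s]])
    moreover have "?V' (?Y', 1) - - f (?Y s) = w' s"
    proof -
      have "?V' (?Y', 1) = ?V' (?Y', 0) + ?V' (0, 1)"
        using V'.add[of "(?Y', 0)" "(0, 1)"] by simp
      moreover have "?V' (?Y', 0) = - (1 / lam) *\<^sub>R ?V' (?Z s, 0)"
        using V'.scaleR[of "- (1 / lam)" "(?Z s, 0)"] by simp
      moreover have "?V' (0, 1) = (1 / lam) *\<^sub>R ?V' (V (?Y s) s, 0) - f (?Y s)"
        using equation[OF s, of "?Y s"] unfolding partial[OF s s] by (simp add: algebra_simps)
      moreover have "w' s = (1 / lam) *\<^sub>R (?V' (V (?Y s) s, 0) - ?V' (?Z s, 0))"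
        using V'.diff[of "(V (?Y s) s, 0)" "(?Z s, 0)"]
        unfolding partial[OF s s] w'_def w_def by simp
      ultimately show ?thesis
        by (simp only: scaleR_diff_right scaleR_minus_left) simp
    qed
    ultimately show ?thesis by simp
  qed
  have "norm (w' s) \<le> K / lam * norm (w s)" if s: "s \<in> {0..T}" for s
  proof -
    have "norm (D_X V (?Y s) s (w s)) \<le> K * norm (w s)"
      using onorm[OF blin[OF s], of "?Y s" "w s"] bound[OF s, of "?Y s"]
      by (meson mult_right_mono norm_ge_zero order_trans)
    then show ?thesis using lam_pos by (simp add: w'_def divide_right_mono)
  qed
  then have "w t = 0"
    using t by (intro backward_gronwall[of t T w w' "K / lam"])
      (auto intro: has_vector_derivative_within_subset[OF w] simp: w_def terminal costate_terminal)
  then show ?thesis by (simp add: w_def solution_def)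
qed

end

section \<open>Existence and uniqueness of the solution\<close>

theorem proposition2:
  fixes F F\<^sub>T :: "'h::{real_inner, complete_space} \<Rightarrow> real"
    and T c lam :: real
  assumes "T > 0"
    and "C2_on F UNIV" and "C2_on F\<^sub>T UNIV"
    and "\<And>X1 X2. norm (grad F X1 - grad F X2) \<le> c * norm (X1 - X2)"
    and "\<And>X1 X2. norm (grad F\<^sub>T X1 - grad F\<^sub>T X2) \<le> c * norm (X1 - X2)"
    and "norm (grad F 0) \<le> c" and "norm (grad F\<^sub>T 0) \<le> c"
    and "lam > c * T * (1 + T)"
  defines "admissible \<equiv> \<lambda>U :: 'h \<Rightarrow> real \<Rightarrow> 'h.
    classical_solution lam T F F\<^sub>T U \<and>
    (\<forall>X. \<forall>t\<in>{0..T}.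
      norm (U X t) \<le> lam * (1 + T) * c * (1 + norm X) / (lam - c * T * (T + 1)) \<and>
      onorm (D_X U X t) \<le> lam * c * (1 + T) / (lam - c * T * (T + 1)))"
  shows "\<exists>U. admissible U \<and>
    (\<forall>V. admissible V \<longrightarrow> (\<forall>X. \<forall>t\<in>{0..T}. V X t = U X t))"
proof -
  obtain H H\<^sub>T :: "'h \<Rightarrow> 'h \<Rightarrow>\<^sub>L 'h"
    where "\<And>X. (grad F has_derivative blinfun_apply (H X)) (at X)" "continuous_on UNIV H"
      and "\<And>X. (grad F\<^sub>T has_derivative blinfun_apply (H\<^sub>T X)) (at X)" "continuous_on UNIV H\<^sub>T"
    using C2_on_imp_grad_C1[OF assms(2)] C2_on_imp_grad_C1[OF assms(3)] by metis
  then interpret characteristics "grad F" "grad F\<^sub>T" H H\<^sub>T c T lam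
    using assms(1,4-8) by unfold_locales auto
  have "admissible solution"
    unfolding admissible_def classical_solution_def
  proof (intro conjI allI ballI)
    fix X and t :: real assume t: "t \<in> {0..T}"
    have "norm (solution X t) \<le> norm (costate X t)"
      unfolding solution_def by (rule norm_bounded)
    also have "\<dots> \<le> c * (1 + T) * (1 + norm X) / (1 - contraction_factor)"
      by (rule costate_growth)
    finally show "norm (solution X t) \<le> lam * (1 + T) * c * (1 + norm X) / (lam - c * T * (T + 1))"
      unfolding gain_eq .
    show "onorm (D_X solution X t) \<le> lam * c * (1 + T) / (lam - c * T * (T + 1))"
      using solution_deriv_norm[of X t] gain_eq[of 1]
      by (simp add: solution_equation(2)[OF t] norm_blinfun.rep_eq mult_ac)
    show "D_t T solution X t - (1 / lam) *\<^sub>R D_X solution X t (solution X t) + grad F X = 0"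
      by (rule solution_equation(1)[OF t])
  qed (rule solution_C1 solution_terminal)+
  moreover have "V X t = solution X t" if V: "admissible V" and t: "t \<in> {0..T}" for V X t
  proof -
    obtain V' :: "'h \<times> real \<Rightarrow> ('h \<times> real) \<Rightarrow>\<^sub>L 'h"
      where V': "\<And>p. p \<in> UNIV \<times> {0..T} \<Longrightarrow>
        ((\<lambda>(X, t). V X t) has_derivative blinfun_apply (V' p)) (at p within UNIV \<times> {0..T})"
      using V unfolding admissible_def classical_solution_def C1_on_def by blast
    show ?thesis
      using V t unfolding admissible_def classical_solution_def
      by (intro solution_unique[where V' = "\<lambda>X t. blinfun_apply (V' (X, t))"
            and K = "lam * c * (1 + T) / (lam - c * T * (T + 1))"] V') auto
  qed
  ultimately show ?thesis by blast
qed

end
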